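(* There is an algorithm which, from a cyclic tag system $\mathcal C$, constructs a finite partial deterministic inverse transducer $\mathcal T_{\mathcal C}$, with initial state denoted $s$, such that the following conditions are equivalent: (i) $\mathcal C$ halts; (ii) $\mathcal T_{\mathcal C}$ has a nontrivial fixed loop at $s$; (iii) $\operatorname{Fix}(\widetilde{\mathcal T}_{\mathcal C})\neq\{1\}$. Moreover, if $g\in\operatorname{Fix}(\widetilde{\mathcal T}_{\mathcal C})$, then the freely reduced representative of $g$ labels a closed path at $s$.
   Context: Cyclic tag systems: a cyclic tag system $\mathcal C$ is a tuple $(u_0,\ldots,u_{m-1})$ ($m\ge1$) of words over $\{0,1\}$ together with a starting word $w_0\in\{0,1\}^*$. Its queue has initial value $W_0=w_0$; if the queue after $n$ steps is $W_n=aW'$ with $a\in\{0,1\}$, then $W_{n+1}=W'$ if $a=0$, and $W_{n+1}=W'u_{n\bmod m}$ if $a=1$. The system halts if some $W_n$ is the empty word. Transducers: for a finite alphabet $A$, let $\widetilde A=A\cup A^{-1}$ ($A^{-1}$ the set of formal inverses), let $F_A$ be the free group on $A$, and for $g\in F_A$ let $\overline g$ be its freely reduced representative word over $\widetilde A$. Maps are written on the right. A finite partial deterministic $\widetilde A$-transducer is $\mathcal T=(Q,q_0,\delta,\lambda)$ with $Q$ a finite set of states, $q_0\in Q$ the initial state, and partial functions $\delta:Q\times\widetilde A\rightharpoonup Q$, $\lambda:Q\times\widetilde A\rightharpoonup\widetilde A^*$ with the same domain. If $(q,a)\delta=r$ and $(q,a)\lambda=U$, we say $q\xrightarrow{a\mid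 U}r$ is an edge. Both are extended to words in the usual way: reading a word follows edges consecutively and concatenates outputs; a word $u$ is readable from $q$ if $(q,u)\delta$ is defined. The transducer is inverse if $p\xrightarrow{a\mid w}q$ is an edge if and only if $q\xrightarrow{a^{-1}\mid w^{-1}}p$ is an edge ($w^{-1}$ being the formal inverse word). An inverse transducer defines a partial map $\widetilde{\mathcal T}:F_A\rightharpoonup F_A$: $g\widetilde{\mathcal T}$ is defined if and only if $\overline g$ is readable from $q_0$, and then it is the element of $F_A$ represented by $(q_0,\overline g)\lambda$. Put $\operatorname{Fix}(\widetilde{\mathcal T})=\{w\in F_A\mid w\widetilde{\mathcal T}\text{ is defined and } w\widetilde{\mathcal T}=w\}$. A word labels a closed path at $q$ if it is readable from $q$ (as input) and reading it from $q$ ends at $q$. A fixed loop at the initial state $q_0$ is an element $w\in\operatorname{Fix}(\widetilde{\mathcal T})$ with $(q_0,\overline w)\delta=q_0$; it is nontrivial if $w\ne1$. *)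

theory Defs
  imports "HOL-Library.Nat_Bijection" "HOL-Algebra.Group"
begin

section \<open>Cyclic tag systems\<close>

text \<open>The bits 0 and 1 are \<open>False\<close> and \<open>True\<close>.\<close>

record cyclic_tag =
  appendants :: "bool list list"
  start :: "bool list"

definition cyclic_tag_system :: "cyclic_tag \<Rightarrow> bool" where
  "cyclic_tag_system C \<longleftrightarrow> length (appendants C) \<ge> 1"

text \<open>There is no step from the empty queue; by convention the sequence then stays empty.\<close>

primrec queue :: "cyclic_tag \<Rightarrow> nat \<Rightarrow> bool list" where
  "queue C 0 = start C"
| "queue C (Suc n) =
    (case queue C n of
      [] \<Rightarrow> []
    | a # W \<Rightarrow> if a then W @ appendants C ! (n mod length (appendants C)) else W)"

definition halts :: "cyclic_tag \<Rightarrow> bool" where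
  "halts C \<longleftrightarrow> (\<exists>n. queue C n = [])"


section \<open>Words over an alphabet with formal inverses, and the free group\<close>

datatype 'a letter = Gen 'a | Inv 'a

type_synonym 'a word = "'a letter list"

primrec letter_inv :: "'a letter \<Rightarrow> 'a letter" where
  "letter_inv (Gen a) = Inv a"
| "letter_inv (Inv a) = Gen a"

definition word_inv :: "'a word \<Rightarrow> 'a word" where
  "word_inv w = rev (map letter_inv w)"

definition letters :: "'a set \<Rightarrow> 'a letter set" where
  "letters A = Gen ` A \<union> Inv ` A"

abbreviation words :: "'a set \<Rightarrow> 'a word set" where
  "words A \<equiv> lists (letters A)"

definition reduced :: "'a word \<Rightarrow> bool" where
  "reduced w \<longleftrightarrow> (\<nexists>u x v. w = u @ [x, letter_inv x] @ v)"

definition cancellation :: "'a set \<Rightarrow> 'a word rel" where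
  "cancellation A = {(u @ [x, letter_inv x] @ v, u @ v) | u x v.
     u \<in> words A \<and> x \<in> letters A \<and> v \<in> words A}"

definition freely_equal :: "'a set \<Rightarrow> 'a word rel" where
  "freely_equal A =
     {(u, v). u \<in> words A \<and> v \<in> words A \<and>
              (u, v) \<in> (cancellation A \<union> (cancellation A)\<inverse>)\<^sup>*}"

definition represented :: "'a set \<Rightarrow> 'a word \<Rightarrow> 'a word set" where
  "represented A w = freely_equal A `` {w}"

definition free_group :: "'a set \<Rightarrow> 'a word set monoid" where
  "free_group A =
     \<lparr> carrier = words A // freely_equal A,
       mult = (\<lambda>g h. \<Union>u\<in>g. \<Union>v\<in>h. represented A (u @ v)),
       one = represented A [] \<rparr>"

text \<open>Well defined on the free group by \<open>reduced_representative_unique\<close> below.\<close>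

definition reduced_rep :: "'a word set \<Rightarrow> 'a word" where
  "reduced_rep g = (THE w. w \<in> g \<and> reduced w)"


section \<open>Transducers\<close>

record ('q, 'a) transducer =
  alphabet :: "'a set"
  states :: "'q set"
  init :: 'q
  delta :: "'q \<Rightarrow> 'a letter \<Rightarrow> 'q option"
  lam :: "'q \<Rightarrow> 'a letter \<Rightarrow> 'a word option"

definition finite_transducer :: "('q, 'a) transducer \<Rightarrow> bool" where
  "finite_transducer T \<longleftrightarrow>
     finite (alphabet T) \<and> finite (states T) \<and> init T \<in> states T \<and>
     (\<forall>q a. (delta T q a = None) \<longleftrightarrow> (lam T q a = None)) \<and>
     (\<forall>q a r. delta T q a = Some r \<longrightarrow> q \<in> states T \<and> a \<in> letters (alphabet T) \<and> r \<in> states T) \<and>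
     (\<forall>q a U. lam T q a = Some U \<longrightarrow> U \<in> words (alphabet T))"

definition edge :: "('q, 'a) transducer \<Rightarrow> 'q \<Rightarrow> 'a letter \<Rightarrow> 'a word \<Rightarrow> 'q \<Rightarrow> bool" where
  "edge T q a U r \<longleftrightarrow> delta T q a = Some r \<and> lam T q a = Some U"

definition inverse_transducer :: "('q, 'a) transducer \<Rightarrow> bool" where
  "inverse_transducer T \<longleftrightarrow>
     (\<forall>p a w q. edge T p a w q \<longleftrightarrow> edge T q (letter_inv a) (word_inv w) p)"

primrec delta_star :: "('q, 'a) transducer \<Rightarrow> 'q \<Rightarrow> 'a word \<Rightarrow> 'q option" where
  "delta_star T q [] = Some q"
| "delta_star T q (a # u) =
    (case delta T q a of None \<Rightarrow> None | Some r \<Rightarrow> delta_star T r u)"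

primrec lam_star :: "('q, 'a) transducer \<Rightarrow> 'q \<Rightarrow> 'a word \<Rightarrow> 'a word option" where
  "lam_star T q [] = Some []"
| "lam_star T q (a # u) =
    (case (delta T q a, lam T q a) of
      (Some r, Some U) \<Rightarrow> map_option (\<lambda>V. U @ V) (lam_star T r u)
    | _ \<Rightarrow> None)"

definition readable :: "('q, 'a) transducer \<Rightarrow> 'q \<Rightarrow> 'a word \<Rightarrow> bool" where
  "readable T q u \<longleftrightarrow> delta_star T q u \<noteq> None"

definition closed_path :: "('q, 'a) transducer \<Rightarrow> 'q \<Rightarrow> 'a word \<Rightarrow> bool" where
  "closed_path T q u \<longleftrightarrow> delta_star T q u = Some q"

definition induced_map :: "('q, 'a) transducer \<Rightarrow> 'a word set \<Rightarrow> 'a word set option" where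
  "induced_map T g =
    (if g \<in> carrier (free_group (alphabet T)) \<and> readable T (init T) (reduced_rep g)
     then map_option (represented (alphabet T)) (lam_star T (init T) (reduced_rep g))
     else None)"

definition Fix :: "('q, 'a) transducer \<Rightarrow> 'a word set set" where
  "Fix T = {g \<in> carrier (free_group (alphabet T)). induced_map T g = Some g}"

definition fixed_loops :: "('q, 'a) transducer \<Rightarrow> 'a word set set" where
  "fixed_loops T = {g \<in> Fix T. closed_path T (init T) (reduced_rep g)}"


section \<open>Algorithms\<close>

text \<open>
  An algorithm is a term for a partial recursive function, acting on Goedel numbers.
  \<open>rec_eval f xs y\<close> says that \<open>f\<close>, applied to the arguments \<open>xs\<close>, terminates with value \<open>y\<close>.
\<close>

datatype recf =
    Zero
  | Succ
  | Proj nat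
  | Comp recf "recf list"
  | PrimRec recf recf
  | Mu recf

inductive rec_eval :: "recf \<Rightarrow> nat list \<Rightarrow> nat \<Rightarrow> bool" where
  zero: "rec_eval Zero xs 0"
| succ: "rec_eval Succ [x] (Suc x)"
| proj: "i < length xs \<Longrightarrow> rec_eval (Proj i) xs (xs ! i)"
| comp: "list_all2 (\<lambda>g y. rec_eval g xs y) gs ys \<Longrightarrow> rec_eval f ys z \<Longrightarrow> rec_eval (Comp f gs) xs z"
| prim_0: "rec_eval f xs y \<Longrightarrow> rec_eval (PrimRec f g) (0 # xs) y"
| prim_Suc: "rec_eval (PrimRec f g) (n # xs) y \<Longrightarrow> rec_eval g (n # y # xs) z \<Longrightarrow>
    rec_eval (PrimRec f g) (Suc n # xs) z"
| mu: "rec_eval f (n # xs) 0 \<Longrightarrow> (\<forall>i<n. \<exists>y. rec_eval f (i # xs) (Suc y)) \<Longrightarrow>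
    rec_eval (Mu f) xs n"

definition cyclic_tag_code :: "cyclic_tag \<Rightarrow> nat" where
  "cyclic_tag_code C =
    (let bits = (\<lambda>u. list_encode (map of_bool u))
     in prod_encode (list_encode (map bits (appendants C)), bits (start C)))"

primrec letter_code :: "nat letter \<Rightarrow> nat" where
  "letter_code (Gen a) = 2 * a"
| "letter_code (Inv a) = 2 * a + 1"

definition word_code :: "nat word \<Rightarrow> nat" where
  "word_code w = list_encode (map letter_code w)"

fun edge_code :: "nat \<times> nat letter \<times> nat word \<times> nat \<Rightarrow> nat" where
  "edge_code (q, a, U, r) =
     prod_encode (q, prod_encode (letter_code a, prod_encode (word_code U, r)))"

text \<open>
  A finite transducer over natural numbers is coded by lists of its generators, states and
  edges, in any order, and its initial state. So a transducer has several codes, but by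
  \<open>transducer_code_unique\<close> below a code determines the transducer.
\<close>

definition transducer_code :: "(nat, nat) transducer \<Rightarrow> nat \<Rightarrow> bool" where
  "transducer_code T c \<longleftrightarrow>
    (\<exists>as qs es.
       set as = alphabet T \<and> set qs = states T \<and>
       set es = {(q, a, U, r). edge T q a U r} \<and>
       c = prod_encode (list_encode as, prod_encode (list_encode qs,
             prod_encode (init T, list_encode (map edge_code es)))))"

definition algorithmic :: "(cyclic_tag \<Rightarrow> (nat, nat) transducer) \<Rightarrow> bool" where
  "algorithmic \<T> \<longleftrightarrow>
    (\<exists>f. \<forall>C. cyclic_tag_system C \<longrightarrow>
       (\<exists>c. rec_eval f [cyclic_tag_code C] c \<and> transducer_code (\<T> C) c))"


section \<open>Well-definedness\<close>

subsection \<open>Reduced representatives\<close>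

lemma letter_inv_inv [simp]: "letter_inv (letter_inv x) = x"
  by (cases x) auto

fun push :: "'a letter \<Rightarrow> 'a word \<Rightarrow> 'a word" where
  "push x [] = [x]"
| "push x (y # w) = (if y = letter_inv x then w else x # y # w)"

definition normal_form :: "'a word \<Rightarrow> 'a word" where
  "normal_form w = foldr push w []"

lemma reduced_Nil: "reduced []"
  by (simp add: reduced_def)

lemma reduced_ConsD: "reduced (x # w) \<Longrightarrow> reduced w"
  unfolding reduced_def by (metis append_Cons)

lemma reduced_Cons_Cons:
  "reduced (x # y # w) \<longleftrightarrow> y \<noteq> letter_inv x \<and> reduced (y # w)"
proof
  assume *: "reduced (x # y # w)"
  then show "y \<noteq> letter_inv x \<and> reduced (y # w)"
    using reduced_ConsD[OF *] unfolding reduced_def by (metis append_Cons append_Nil)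
next
  assume *: "y \<noteq> letter_inv x \<and> reduced (y # w)"
  show "reduced (x # y # w)"
    unfolding reduced_def
  proof clarify
    fix u z v assume eq: "x # y # w = u @ [z, letter_inv z] @ v"
    show False
    proof (cases u)
      case Nil
      with eq * show False by simp
    next
      case (Cons a u')
      with eq have "y # w = u' @ [z, letter_inv z] @ v" by simp
      with * show False unfolding reduced_def by blast
    qed
  qed
qed

lemma reduced_single: "reduced [x]"
  by (auto simp: reduced_def append_eq_Cons_conv Cons_eq_append_conv)

lemma reduced_push: "reduced w \<Longrightarrow> reduced (push x w)"
  by (cases w) (auto simp: reduced_single reduced_Cons_Cons dest: reduced_ConsD)

lemma push_push: "reduced w \<Longrightarrow> push x (push (letter_inv x) w) = w"
proof (cases w)
  case (Cons y v)
  assume "reduced w"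
  then show ?thesis
    using Cons by (cases v) (auto simp: reduced_Cons_Cons)
qed auto

lemma reduced_foldr_push: "reduced v \<Longrightarrow> reduced (foldr push w v)"
  by (induction w) (auto intro: reduced_push)

lemma reduced_normal_form: "reduced (normal_form w)"
  by (simp add: normal_form_def reduced_foldr_push reduced_Nil)

lemma normal_form_cancel: "normal_form (u @ [x, letter_inv x] @ v) = normal_form (u @ v)"
  by (simp add: normal_form_def push_push reduced_foldr_push reduced_Nil)

lemma normal_form_reduced: "reduced w \<Longrightarrow> normal_form w = w"
proof (induction w)
  case (Cons x w)
  then have "normal_form w = w" by (auto dest: reduced_ConsD)
  then show ?case
    using Cons.prems by (cases w) (auto simp: normal_form_def reduced_Cons_Cons)
qed (simp add: normal_form_def)

lemma normal_form_freely_equal: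
  assumes "(u, v) \<in> freely_equal A"
  shows "normal_form u = normal_form v"
proof -
  have "(u, v) \<in> (cancellation A \<union> (cancellation A)\<inverse>)\<^sup>*"
    using assms by (simp add: freely_equal_def)
  then show ?thesis
  proof (induction rule: rtrancl_induct)
    case (step y z)
    have "normal_form y = normal_form z"
      using step.hyps(2) normal_form_cancel unfolding cancellation_def by fastforce
    with step.IH show ?case by simp
  qed simp
qed

lemma letter_inv_letters [simp]: "letter_inv x \<in> letters A \<longleftrightarrow> x \<in> letters A"
  by (cases x) (auto simp: letters_def)

lemma freely_equal_equiv: "equiv (words A) (freely_equal A)"
proof (rule equivI)
  show "freely_equal A \<subseteq> words A \<times> words A"
    by (auto simp: freely_equal_def)
  show "refl_on (words A) (freely_equal A)"
    by (auto simp: refl_on_def freely_equal_def)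
  have "sym ((cancellation A \<union> (cancellation A)\<inverse>)\<^sup>*)"
    by (intro sym_rtrancl sym_Un_converse)
  then show "sym (freely_equal A)"
    by (auto simp: sym_def freely_equal_def)
  show "trans (freely_equal A)"
    by (auto simp: trans_def freely_equal_def)
qed

lemma cancellation_freely_equal: "cancellation A \<subseteq> freely_equal A"
proof
  fix p assume p: "p \<in> cancellation A"
  then have "p \<in> words A \<times> words A"
    by (auto simp: cancellation_def)
  with p show "p \<in> freely_equal A"
    by (cases p) (simp add: freely_equal_def r_into_rtrancl)
qed

lemma normal_form_represents: "w \<in> words A \<Longrightarrow> (w, normal_form w) \<in> freely_equal A"
proof (induction "length w" arbitrary: w rule: less_induct)
  case less
  show ?case
  proof (cases "reduced w")
    case True
    then show ?thesis
      using less.prems freely_equal_equiv[of A] by (simp add: normal_form_reduced equiv_def refl_on_def)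
  next
    case False
    then obtain u x v where w: "w = u @ [x, letter_inv x] @ v"
      unfolding reduced_def by blast
    then have step: "(w, u @ v) \<in> freely_equal A"
      using less.prems by (intro subsetD[OF cancellation_freely_equal]) (auto simp: cancellation_def)
    have "(u @ v, normal_form (u @ v)) \<in> freely_equal A"
      using less.prems w by (intro less.hyps) auto
    with step show ?thesis
      using freely_equal_equiv[of A] unfolding w normal_form_cancel equiv_def by (meson transD)
  qed
qed

lemma reduced_representative_unique:
  assumes "g \<in> carrier (free_group A)"
  shows "\<exists>!w. w \<in> g \<and> reduced w"
proof -
  obtain u where u: "u \<in> words A" "g = freely_equal A `` {u}"
    using assms by (auto simp: free_group_def quotient_def)
  show ?thesis
  proof
    show "normal_form u \<in> g \<and> reduced (normal_form u)"
      using u normal_form_represents reduced_normal_form by auto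
    fix w assume "w \<in> g \<and> reduced w"
    then show "w = normal_form u"
      using u normal_form_freely_equal normal_form_reduced by (metis Image_singleton_iff)
  qed
qed


subsection \<open>Determinism of evaluation and decoding\<close>

inductive_cases rec_eval_ZeroE: "rec_eval Zero xs y"
inductive_cases rec_eval_SuccE: "rec_eval Succ xs y"
inductive_cases rec_eval_ProjE: "rec_eval (Proj i) xs y"
inductive_cases rec_eval_CompE: "rec_eval (Comp f gs) xs y"
inductive_cases rec_eval_Prim0E: "rec_eval (PrimRec f g) (0 # xs) y"
inductive_cases rec_eval_PrimSucE: "rec_eval (PrimRec f g) (Suc n # xs) y"
inductive_cases rec_eval_MuE: "rec_eval (Mu f) xs y"

lemma rec_eval_deterministic:
  "rec_eval f xs y \<Longrightarrow> rec_eval f xs y' \<Longrightarrow> y = y'"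
proof (induction f xs y arbitrary: y' rule: rec_eval.induct)
  case (comp xs gs ys f z)
  from comp.prems obtain ys' where
    ys': "list_all2 (\<lambda>g y. rec_eval g xs y) gs ys'" "rec_eval f ys' y'"
    by (auto elim: rec_eval_CompE)
  have "ys = ys'"
    using comp.hyps(1) comp.IH(1) ys'(1) by (auto simp: list_all2_conv_all_nth intro!: nth_equalityI)
  with ys' comp.IH(2) show ?case by simp
next
  case (mu f n xs)
  from mu.prems have y': "rec_eval f (y' # xs) 0" "\<forall>i<y'. \<exists>y. rec_eval f (i # xs) (Suc y)"
    by (auto elim: rec_eval_MuE)
  show ?case
  proof (rule linorder_cases[of n y'])
    assume "n < y'"
    then show ?thesis using y'(2) mu.IH(1) by (metis nat.distinct(1))
  next
    assume "y' < n"
    then show ?thesis using y'(1) mu.IH(2) by (metis nat.distinct(1))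
  qed
next
  case (prim_Suc f g n xs y z)
  from prim_Suc.prems obtain v where "rec_eval (PrimRec f g) (n # xs) v" "rec_eval g (n # v # xs) y'"
    by (rule rec_eval_PrimSucE)
  with prim_Suc.IH show ?case by metis
qed (blast elim: rec_eval_ZeroE rec_eval_SuccE rec_eval_ProjE rec_eval_Prim0E)+

lemma bits_code_inj: "inj (\<lambda>u. list_encode (map (of_bool :: bool \<Rightarrow> nat) u))"
proof (rule injI)
  fix u v assume "list_encode (map (of_bool :: bool \<Rightarrow> nat) u) = list_encode (map of_bool v)"
  moreover have "inj (of_bool :: bool \<Rightarrow> nat)"
    by (simp add: inj_def)
  ultimately show "u = v"
    by (simp add: list_encode_eq inj_map_eq_map)
qed

lemma cyclic_tag_code_inj: "inj cyclic_tag_code"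
proof (rule injI)
  fix C D assume "cyclic_tag_code C = cyclic_tag_code D"
  then have "appendants C = appendants D" "start C = start D"
    using injD[OF bits_code_inj] inj_map_eq_map[OF bits_code_inj]
    unfolding cyclic_tag_code_def Let_def list_encode_eq prod_encode_eq prod.inject by blast+
  then show "C = D" by simp
qed

lemma letter_code_inj: "inj letter_code"
proof (rule injI)
  fix x y assume "letter_code x = letter_code y"
  then show "x = y" by (cases x; cases y) (simp_all, presburger+)
qed

lemma edge_code_inj: "inj edge_code"
proof (rule injI)
  fix x y assume eq: "edge_code x = edge_code y"
  obtain q a U r where x: "x = (q, a, U, r)" by (metis prod_cases4)
  obtain q' a' U' r' where y: "y = (q', a', U', r')" by (metis prod_cases4)
  show "x = y"
    using eq unfolding x y
    by (simp add: word_code_def list_encode_eq inj_eq[OF letter_code_inj]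
        inj_map_eq_map[OF letter_code_inj])
qed

lemma transducer_code_unique:
  assumes "finite_transducer S" "finite_transducer T" "transducer_code S c" "transducer_code T c"
  shows "S = T"
proof -
  from assms(3) obtain as qs es where 1:
    "set as = alphabet S" "set qs = states S" "set es = {(q, a, U, r). edge S q a U r}"
    "c = prod_encode (list_encode as, prod_encode (list_encode qs,
           prod_encode (init S, list_encode (map edge_code es))))"
    unfolding transducer_code_def by blast
  from assms(4) obtain as' qs' es' where 2:
    "set as' = alphabet T" "set qs' = states T" "set es' = {(q, a, U, r). edge T q a U r}"
    "c = prod_encode (list_encode as', prod_encode (list_encode qs',
           prod_encode (init T, list_encode (map edge_code es'))))"
    unfolding transducer_code_def by blast
  have eq: "as = as'" "qs = qs'" "init S = init T" "es = es'"
    using 1(4) 2(4) by (simp_all add: list_encode_eq inj_map_eq_map[OF edge_code_inj])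
  have parts: "alphabet S = alphabet T" "states S = states T" "init S = init T"
    and edges: "{(q, a, U, r). edge S q a U r} = {(q, a, U, r). edge T q a U r}"
    using eq 1(1-3) 2(1-3) by simp_all
  have edge: "edge S q a U r \<longleftrightarrow> edge T q a U r" for q a U r
  proof -
    have "(q, a, U, r) \<in> {(q, a, U, r). edge S q a U r} \<longleftrightarrow>
          (q, a, U, r) \<in> {(q, a, U, r). edge T q a U r}"
      by (simp only: edges)
    then show ?thesis by simp
  qed
  have "delta S q a = delta T q a \<and> lam S q a = lam T q a" for q a
    using edge[of q a] assms(1,2) unfolding edge_def finite_transducer_def
    by (metis not_None_eq)
  with parts show ?thesis
    by (intro transducer.equality) (auto intro!: ext)
qed

end

theory Submission
  imports Defs
begin

text \<open>
  The transducer reads the history of the queue and writes the letters that are appended: besides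
  the initial state it has one state per index into the cyclic program, reading the bit 1 in state
  \<open>i\<close> outputs \<open>u\<^sub>i\<close>, and every read bit is replaced by a blank. After reading \<open>u\<close>
  the difference \<open>u\<inverse> (s, u)\<lambda>\<close> is then the queue.

  Two copies of the letters, with the output always in the other copy, prevent a letter from
  occurring in its own output. Hence every edge between configurations (state, difference), apart
  from the one leaving \<open>(s, 1)\<close>, reads the first letter of the difference at one of its ends:
  the configurations form a functional graph, even off the intended computation. A reduced fixed word therefore consists of
  a forward run from \<open>(s, 1)\<close> followed by a reversed forward run, and a nontrivial one exists
  iff the forward orbit of \<open>(s, 1)\<close> is eventually periodic. Blanks are only rotated, so the
  orbit becomes periodic once no bits are left; each read bit adds a blank, so otherwise it is not
  periodic. The difference never becomes trivial on the orbit, which makes all fixed words loops.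
\<close>

section \<open>Free reduction\<close>

lemma letter_inv_eq_iff: "letter_inv x = y \<longleftrightarrow> x = letter_inv y"
  by auto

lemma word_inv_Nil [simp]: "word_inv [] = []"
  by (simp add: word_inv_def)

lemma word_inv_Cons: "word_inv (x # u) = word_inv u @ [letter_inv x]"
  by (simp add: word_inv_def)

lemma word_inv_append: "word_inv (u @ v) = word_inv v @ word_inv u"
  by (simp add: word_inv_def)

lemma word_inv_inv [simp]: "word_inv (word_inv u) = u"
  by (simp add: word_inv_def rev_map comp_def)

lemma in_set_word_inv: "x \<in> set (word_inv u) \<longleftrightarrow> letter_inv x \<in> set u"
  by (force simp: word_inv_def letter_inv_eq_iff)

lemma word_inv_in_words: "u \<in> words A \<Longrightarrow> word_inv u \<in> words A"
  by (auto simp: word_inv_def)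

lemma reduced_appendD: "reduced (u @ v) \<Longrightarrow> reduced u" "reduced (u @ v) \<Longrightarrow> reduced v"
  unfolding reduced_def by (metis append.assoc)+

lemma normal_form_Nil [simp]: "normal_form [] = []"
  by (simp add: normal_form_def)

lemma normal_form_append: "normal_form (u @ v) = foldr push u (normal_form v)"
  by (simp add: normal_form_def)

lemma normal_form_Cons: "normal_form (x # u) = push x (normal_form u)"
  by (simp add: normal_form_def)

lemma normal_form_idem [simp]: "normal_form (normal_form u) = normal_form u"
  by (simp add: normal_form_reduced reduced_normal_form)

lemma normal_form_append_right [simp]: "normal_form (u @ normal_form v) = normal_form (u @ v)"
  by (simp add: normal_form_append)

text \<open>If \<open>push\<close> cancels the head of \<open>w\<close>, two opposite pushes onto a
  reduced word remain, and \<open>push_push\<close> removes them.\<close>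

lemma foldr_push_push:
  "reduced z \<Longrightarrow> foldr push (push x w) z = push x (foldr push w z)"
  by (cases w) (auto simp: push_push reduced_foldr_push)

lemma normal_form_append_left [simp]: "normal_form (normal_form u @ v) = normal_form (u @ v)"
proof -
  have "foldr push (normal_form u) z = foldr push u z" if "reduced z" for z
    using that by (induction u) (auto simp: normal_form_Cons foldr_push_push)
  then show ?thesis
    by (simp add: normal_form_append reduced_normal_form)
qed

lemma normal_form_append_cong:
  "normal_form u = normal_form u' \<Longrightarrow> normal_form v = normal_form v' \<Longrightarrow>
    normal_form (u @ v) = normal_form (u' @ v')"
  by (metis normal_form_append_left normal_form_append_right)

lemma normal_form_replace: "normal_form v = normal_form v' \<Longrightarrow> normal_form (u @ v @ w) = normal_form (u @ v' @ w)"
  by (intro normal_form_append_cong) auto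

lemma normal_form_cancel_right: "normal_form (u @ x # letter_inv x # v) = normal_form (u @ v)"
  using normal_form_cancel[of u x v] by simp

lemma normal_form_cancel_left: "normal_form (u @ letter_inv x # x # v) = normal_form (u @ v)"
  using normal_form_cancel[of u "letter_inv x" v] by simp

lemma normal_form_word_inv_right: "normal_form (u @ w @ word_inv w @ v) = normal_form (u @ v)"
proof (induction w arbitrary: u v)
  case (Cons x w)
  have "normal_form (u @ (x # w) @ word_inv (x # w) @ v)
      = normal_form ((u @ [x]) @ w @ word_inv w @ (letter_inv x # v))"
    by (simp add: word_inv_Cons)
  also have "\<dots> = normal_form (u @ v)"
    by (subst Cons.IH) (simp add: normal_form_cancel_right)
  finally show ?case .
qed simp

lemma normal_form_word_inv_left: "normal_form (u @ word_inv w @ w @ v) = normal_form (u @ v)"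
  using normal_form_word_inv_right[of u "word_inv w" v] by simp

text \<open>Applied with \<open>v\<close> the output on \<open>u\<close>, this turns the fixed-point
  equation into triviality of the residual.\<close>

lemma normal_form_eq_Nil_iff: "normal_form (word_inv u @ v) = [] \<longleftrightarrow> normal_form u = normal_form v"
proof
  assume "normal_form (word_inv u @ v) = []"
  then have "normal_form (u @ word_inv u @ v) = normal_form (u @ [])"
    by (intro normal_form_append_cong) auto
  then show "normal_form u = normal_form v"
    using normal_form_word_inv_right[of "[]" u v] by simp
next
  assume "normal_form u = normal_form v"
  then have "normal_form (word_inv u @ v) = normal_form (word_inv u @ u)"
    by (intro normal_form_append_cong) auto
  then show "normal_form (word_inv u @ v) = []"
    using normal_form_word_inv_left[of "[]" u "[]"] by simp
qed

lemma normal_form_word_inv_cong: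
  assumes "normal_form u = normal_form v"
  shows "normal_form (word_inv u) = normal_form (word_inv v)"
proof -
  have "normal_form (word_inv v) = normal_form (word_inv u @ u @ word_inv v)"
    using normal_form_word_inv_left[of "[]" u "word_inv v"] by simp
  also have "\<dots> = normal_form (word_inv u @ v @ word_inv v)"
    using assms by (intro normal_form_append_cong) auto
  also have "\<dots> = normal_form (word_inv u)"
    using normal_form_word_inv_right[of "word_inv u" v "[]"] by simp
  finally show ?thesis by simp
qed

lemma reduced_map_Gen: "reduced (map Gen v)"
proof (induction v)
  case (Cons x v)
  then show ?case by (cases v) (auto simp: reduced_single reduced_Cons_Cons)
qed (simp add: reduced_Nil)

lemma reduced_snoc:
  "reduced e \<Longrightarrow> e = [] \<or> last e \<noteq> letter_inv y \<Longrightarrow> reduced (e @ [y])"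
proof (induction e)
  case (Cons x e)
  then show ?case
    by (cases e) (auto simp: reduced_Cons_Cons reduced_single split: if_splits)
qed (simp add: reduced_single)

lemma normal_form_snoc:
  assumes "reduced e"
  shows "normal_form (e @ [y]) = (if e \<noteq> [] \<and> last e = letter_inv y then butlast e else e @ [y])"
proof (cases "e \<noteq> [] \<and> last e = letter_inv y")
  case True
  then have e: "e = butlast e @ [letter_inv y]"
    by (metis append_butlast_last_id)
  have "normal_form (e @ [y]) = normal_form (butlast e @ letter_inv y # y # [])"
    by (subst e) simp
  also have "\<dots> = butlast e"
    using assms e reduced_appendD(1) normal_form_cancel_left[of "butlast e" y "[]"] normal_form_reduced
    by (metis append_Nil2)
  finally show ?thesis using True by simp
next
  case False
  with assms have "reduced (e @ [y])"
    by (intro reduced_snoc) auto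
  then have "normal_form (e @ [y]) = e @ [y]"
    by (rule normal_form_reduced)
  with False show ?thesis by auto
qed

section \<open>First letters of reduced words\<close>

definition starts_with :: "'a \<Rightarrow> 'a list \<Rightarrow> bool" where
  "starts_with x d \<longleftrightarrow> d \<noteq> [] \<and> hd d = x"

lemma starts_with_Nil [simp]: "\<not> starts_with x []"
  by (simp add: starts_with_def)

lemma starts_with_Cons [simp]: "starts_with x (y # d) \<longleftrightarrow> y = x"
  by (simp add: starts_with_def)

text \<open>Appending a letter to a nonempty reduced word adds or removes a letter at its end, so a
  new first letter can appear only on an empty word.\<close>

lemma not_starts_with_snoc:
  assumes "reduced e" "\<not> starts_with x e" "e \<noteq> [] \<or> y \<noteq> x"
  shows "\<not> starts_with x (normal_form (e @ [y]))"
  unfolding normal_form_snoc[OF assms(1)]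
  using assms(2,3) by (cases e) (auto simp: starts_with_def)

text \<open>While \<open>U\<close> is appended letter by letter, a new first letter arises only
  after complete cancellation, and it is then a letter of \<open>U\<close>.\<close>

lemma not_starts_with_append:
  assumes "reduced d" "\<not> starts_with x d" "x \<notin> set U"
  shows "\<not> starts_with x (normal_form (d @ U))"
  using assms
proof (induction U arbitrary: d)
  case (Cons y U)
  have "\<not> starts_with x (normal_form (normal_form (d @ [y]) @ U))"
    using Cons.prems by (intro Cons.IH not_starts_with_snoc) (auto simp: reduced_normal_form)
  then show ?case by (metis append.assoc append_Cons append_Nil normal_form_append_left)
qed (simp add: normal_form_reduced)

lemma push_not_starts_with: "\<not> starts_with (letter_inv x) e \<Longrightarrow> push x e = x # e"
  by (cases e) auto

section \<open>Group elements and their normal forms\<close>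

lemma words_normal_form: "w \<in> words A \<Longrightarrow> normal_form w \<in> words A"
  using normal_form_represents[of w A] by (simp add: freely_equal_def)

lemma freely_equal_iff:
  assumes "u \<in> words A" "v \<in> words A"
  shows "(u, v) \<in> freely_equal A \<longleftrightarrow> normal_form u = normal_form v"
proof
  assume eq: "normal_form u = normal_form v"
  have "(u, normal_form u) \<in> freely_equal A" "(v, normal_form v) \<in> freely_equal A"
    using assms by (simp_all add: normal_form_represents)
  with eq show "(u, v) \<in> freely_equal A"
    using freely_equal_equiv[of A] unfolding equiv_def by (metis symD transD)
qed (rule normal_form_freely_equal)

lemma represented_eq_iff:
  "u \<in> words A \<Longrightarrow> v \<in> words A \<Longrightarrow> represented A u = represented A v \<longleftrightarrow> normal_form u = normal_form v"
  using eq_equiv_class_iff[OF freely_equal_equiv] freely_equal_iff by (metis represented_def)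

lemma represented_in_carrier: "w \<in> words A \<Longrightarrow> represented A w \<in> carrier (free_group A)"
  by (auto simp: free_group_def represented_def quotient_def)

lemma reduced_rep_represented:
  assumes "w \<in> words A"
  shows "reduced_rep (represented A w) = normal_form w"
  unfolding reduced_rep_def
proof (rule the1_equality)
  show "\<exists>!v. v \<in> represented A w \<and> reduced v"
    by (intro reduced_representative_unique[of _ A] represented_in_carrier assms)
  show "normal_form w \<in> represented A w \<and> reduced (normal_form w)"
    using assms normal_form_represents by (auto simp: represented_def reduced_normal_form)
qed

section \<open>Paths in inverse transducers\<close>

definition path :: "('q, 'a) transducer \<Rightarrow> 'q \<Rightarrow> 'a word \<Rightarrow> 'a word \<Rightarrow> 'q \<Rightarrow> bool" where
  "path T q u V r \<longleftrightarrow> delta_star T q u = Some r \<and> lam_star T q u = Some V"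

lemma path_Nil [simp]: "path T q [] V r \<longleftrightarrow> V = [] \<and> r = q"
  by (auto simp: path_def)

lemma path_Cons:
  "path T q (a # u) V r \<longleftrightarrow> (\<exists>U p V'. edge T q a U p \<and> path T p u V' r \<and> V = U @ V')"
  by (auto simp: path_def edge_def split: option.splits)

lemma path_append:
  "path T q (u @ v) V r \<longleftrightarrow> (\<exists>p V1 V2. path T q u V1 p \<and> path T p v V2 r \<and> V = V1 @ V2)"
proof (induction u arbitrary: q V)
  case (Cons a u)
  then show ?case by (simp add: path_Cons) (metis append.assoc)
qed simp

lemma edge_deterministic: "edge T q a U r \<Longrightarrow> edge T q a U' r' \<Longrightarrow> U = U' \<and> r = r'"
  by (simp add: edge_def)

lemma path_word_inv:
  assumes "inverse_transducer T" "path T q u V r"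
  shows "path T r (word_inv u) (word_inv V) q"
  using assms(2)
proof (induction u arbitrary: q V)
  case (Cons a u)
  then obtain U p V' where *: "edge T q a U p" "path T p u V' r" "V = U @ V'"
    by (auto simp: path_Cons)
  then have "edge T p (letter_inv a) (word_inv U) q"
    using assms(1) by (simp add: inverse_transducer_def)
  with * Cons.IH show ?case
    by (auto simp: word_inv_Cons word_inv_append path_append path_Cons)
qed simp

text \<open>Where two letters cancel, determinism forces the second edge to be the first one
  traversed backwards, so the outputs cancel too.\<close>

lemma path_normal_form:
  assumes "inverse_transducer T" "path T q u V r"
  shows "\<exists>V'. path T q (normal_form u) V' r \<and> normal_form V' = normal_form V"
  using assms(2)
proof (induction u arbitrary: q V)
  case (Cons a u)
  then obtain U p V1 where 1: "edge T q a U p" "path T p u V1 r" "V = U @ V1"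
    by (auto simp: path_Cons)
  from Cons.IH[OF 1(2)] obtain V2 where
    2: "path T p (normal_form u) V2 r" "normal_form V2 = normal_form V1" by blast
  have V: "normal_form V = normal_form (U @ V2)"
    using 1(3) 2(2) by (auto intro: normal_form_append_cong)
  show ?case
  proof (cases "starts_with (letter_inv a) (normal_form u)")
    case True
    then obtain w where w: "normal_form u = letter_inv a # w"
      by (cases "normal_form u") auto
    with 2(1) obtain U' q' V3 where
      3: "edge T p (letter_inv a) U' q'" "path T q' w V3 r" "V2 = U' @ V3"
      by (auto simp: path_Cons)
    have "edge T p (letter_inv a) (word_inv U) q"
      using 1(1) assms(1) by (simp add: inverse_transducer_def)
    with 3(1) have "U' = word_inv U" "q' = q"
      by (auto dest: edge_deterministic)
    with 3 V show ?thesis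
      using normal_form_word_inv_right[of "[]" U V3] w by (auto simp: normal_form_Cons)
  next
    case False
    with 1(1) 2(1) V show ?thesis
      by (auto simp: normal_form_Cons push_not_starts_with path_Cons)
  qed
qed simp

lemma path_words:
  "finite_transducer T \<Longrightarrow> path T q u V r \<Longrightarrow> u \<in> words (alphabet T) \<and> V \<in> words (alphabet T)"
proof (induction u arbitrary: q V)
  case (Cons a u)
  then obtain U p V1 where 1: "edge T q a U p" "path T p u V1 r" "V = U @ V1"
    by (auto simp: path_Cons)
  then have "a \<in> letters (alphabet T)" "U \<in> words (alphabet T)"
    using Cons.prems(1) unfolding finite_transducer_def edge_def by blast+
  with Cons.IH[OF Cons.prems(1) 1(2)] 1(3) show ?case by simp
qed simp

lemma readable_path:
  assumes "finite_transducer T" "readable T q u"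
  shows "\<exists>V r. path T q u V r"
  using assms(2)
proof (induction u arbitrary: q)
  case (Cons a u)
  then obtain p where p: "delta T q a = Some p" "readable T p u"
    by (auto simp: readable_def split: option.splits)
  then obtain U where "lam T q a = Some U"
    using assms(1) unfolding finite_transducer_def by (metis not_None_eq)
  with p Cons.IH[OF p(2)] show ?case
    by (auto simp: path_Cons edge_def)
qed (metis path_Nil)

text \<open>Replaces equivalence classes by reduced words and paths. By \<open>path_words\<close> a
  word labelling a path lies over the alphabet automatically.\<close>

lemma Fix_iff:
  assumes "finite_transducer T"
  shows "g \<in> Fix T \<longleftrightarrow>
    (\<exists>w V q. reduced w \<and> path T (init T) w V q \<and> normal_form V = w \<and> g = represented (alphabet T) w)"
proof
  assume g: "g \<in> Fix T"
  then obtain u where u: "u \<in> words (alphabet T)" "g = represented (alphabet T) u"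
    by (auto simp: Fix_def free_group_def quotient_def represented_def)
  define w where "w = normal_form u"
  have w: "w \<in> words (alphabet T)" "reduced w" "g = represented (alphabet T) w" "reduced_rep g = w"
    using u by (simp_all add: w_def words_normal_form reduced_normal_form represented_eq_iff
        reduced_rep_represented)
  have *: "readable T (init T) w"
    "map_option (represented (alphabet T)) (lam_star T (init T) w) = Some g"
    using g w(4) by (auto simp: Fix_def induced_map_def split: if_splits)
  from readable_path[OF assms *(1)] obtain V q where V: "path T (init T) w V q" by blast
  then have "represented (alphabet T) V = represented (alphabet T) w"
    using * w by (auto simp: path_def)
  then have "normal_form V = w"
    using V w path_words[OF assms V] by (simp add: represented_eq_iff normal_form_reduced)
  with V w show "\<exists>w V q. reduced w \<and> path T (init T) w V q \<and> normal_form V = w \<and>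
      g = represented (alphabet T) w" by blast
next
  assume "\<exists>w V q. reduced w \<and> path T (init T) w V q \<and> normal_form V = w \<and>
      g = represented (alphabet T) w"
  then obtain w V q where *: "reduced w" "path T (init T) w V q" "normal_form V = w"
    "g = represented (alphabet T) w" by blast
  have "w \<in> words (alphabet T)" "V \<in> words (alphabet T)"
    using path_words[OF assms *(2)] by auto
  with * show "g \<in> Fix T"
    by (auto simp: Fix_def induced_map_def represented_in_carrier reduced_rep_represented
        normal_form_reduced readable_def path_def represented_eq_iff)
qed

lemma one_free_group: "\<one>\<^bsub>free_group A\<^esub> = represented A []"
  by (simp add: free_group_def)

lemma one_in_Fix: "finite_transducer T \<Longrightarrow> \<one>\<^bsub>free_group (alphabet T)\<^esub> \<in> Fix T"
  unfolding Fix_iff one_free_group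
  by (intro exI[of _ "[]"] exI[of _ "init T"]) (simp add: reduced_Nil)

section \<open>The configuration graph\<close>

text \<open>
  A configuration consists of a state and the reduced residual \<open>u\<inverse> (q\<^sub>0, u)\<lambda>\<close>
  of the word \<open>u\<close> read so far. Outside the marked edge no letter occurs in its own output,
  so that reading a letter either removes it from the front of the residual or leaves its
  inverse there.
\<close>

locale marked_transducer =
  fixes T :: "('q, 'a) transducer" and h :: "'a letter"
  assumes inverse: "inverse_transducer T"
    and marked: "edge T p h U q \<Longrightarrow> p = init T \<and> (\<exists>V. U = h # V \<and> h \<notin> set V)"
    and unmarked: "edge T p x U q \<Longrightarrow> x \<noteq> h \<Longrightarrow> x \<noteq> letter_inv h \<Longrightarrow> x \<notin> set U"
begin

text \<open>The second conjunct orients the edges: a step consumes the first letter of the residual.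
  The configuration \<open>(init T, [])\<close> has no such letter and is assigned the marked one,
  so every configuration has at most one step.\<close>

definition step :: "'q \<times> 'a word \<Rightarrow> 'a letter \<Rightarrow> 'q \<times> 'a word \<Rightarrow> bool" where
  "step c x c' \<longleftrightarrow>
     (\<exists>U. edge T (fst c) x U (fst c') \<and> snd c' = normal_form (letter_inv x # snd c @ U)) \<and>
     (starts_with x (snd c) \<or> c = (init T, []) \<and> x = h)"

inductive run :: "'q \<times> 'a word \<Rightarrow> 'a word \<Rightarrow> 'q \<times> 'a word \<Rightarrow> bool" where
  Nil: "run c [] c"
| Cons: "step c x c' \<Longrightarrow> run c' l c'' \<Longrightarrow> run c (x # l) c''"

inductive_simps run_Nil [simp]: "run c [] c'"
inductive_simps run_Cons: "run c (x # l) c'"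

lemma run_append: "run c (l @ l') c'' \<longleftrightarrow> (\<exists>c'. run c l c' \<and> run c' l' c'')"
  by (induction l arbitrary: c) (auto simp: run_Cons)

lemma step_deterministic: "step c x c' \<Longrightarrow> step c y c'' \<Longrightarrow> x = y \<and> c' = c''"
  by (cases c', cases c'') (auto simp: step_def starts_with_def dest: edge_deterministic)

text \<open>The configuration graph is functional by \<open>step_deterministic\<close>, so one of
  two runs from a common start continues the other.\<close>

lemma run_comparable:
  "run c l e \<Longrightarrow> run c l' e' \<Longrightarrow>
    (\<exists>k. l' = l @ k \<and> run e k e') \<or> (\<exists>k. l = l' @ k \<and> run e' k e)"
proof (induction arbitrary: l' rule: run.induct)
  case (Cons c x c' l c'')
  show ?case
  proof (cases l')
    case Nil
    with Cons show ?thesis by (auto intro: run.Cons)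
  next
    case (Cons y k)
    with Cons.prems obtain d where d: "step c y d" "run d k e'"
      by (auto simp: run_Cons)
    with Cons.hyps(1) have "y = x" "d = c'"
      by (auto dest: step_deterministic)
    with Cons.IH[of k] d Cons show ?thesis by simp
  qed
qed simp

text \<open>The runs are comparable and differ, so the longer one leaves \<open>e\<close> and
  returns to it.\<close>

lemma run_loop:
  assumes "run c l e" "run c l' e" "l \<noteq> l'"
  shows "\<exists>l k. k \<noteq> [] \<and> run c l e \<and> run e k e"
  using run_comparable[OF assms(1,2)] assms by fastforce

text \<open>Let \<open>e\<close> be the normal form of \<open>d @ U\<close>. If \<open>e\<close>
  does not begin with \<open>x\<close>, then \<open>d'\<close> begins with the inverse of
  \<open>x\<close>, which the reverse edge consumes. If it does and \<open>x\<close> is not in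
  \<open>U\<close>, then already \<open>d\<close> begins with \<open>x\<close>. Only the marked
  letter and its inverse need separate care.\<close>

lemma step_dichotomy:
  assumes edge: "edge T q x U q'" and d: "reduced d" and d': "d' = normal_form (letter_inv x # d @ U)"
  shows "step (q, d) x (q', d') \<or> step (q', d') (letter_inv x) (q, d)"
proof -
  have edge': "edge T q' (letter_inv x) (word_inv U) q"
    using edge inverse by (simp add: inverse_transducer_def)
  have "normal_form (x # d' @ word_inv U) = normal_form ([x] @ (letter_inv x # d @ U) @ word_inv U)"
    using normal_form_replace[of d' "letter_inv x # d @ U" "[x]" "word_inv U"] by (simp add: d')
  also have "\<dots> = normal_form (d @ U @ word_inv U)"
    using normal_form_cancel_right[of "[]" x "d @ U @ word_inv U"] by simp
  also have "\<dots> = d"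
    using normal_form_word_inv_right[of d U "[]"] d by (simp add: normal_form_reduced)
  finally have reverse: "d = normal_form (x # d' @ word_inv U)" by simp
  define e where "e = normal_form (d @ U)"
  have d'e: "d' = push (letter_inv x) e"
    by (simp add: d' e_def normal_form_Cons)
  have "step (q', d') (letter_inv x) (q, d)" if "starts_with (letter_inv x) d' \<or> q' = init T \<and> d' = [] \<and> letter_inv x = h"
    using that edge' reverse by (auto simp: step_def)
  moreover have "step (q, d) x (q', d')" if "starts_with x d \<or> q = init T \<and> d = [] \<and> x = h"
    using that edge d' by (auto simp: step_def)
  moreover have "starts_with (letter_inv x) d'" if "\<not> starts_with x e"
    using that d'e by (simp add: push_not_starts_with)
  moreover have "starts_with x d \<or> q = init T \<and> d = [] \<and> x = h \<or> \<not> starts_with x e \<or>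
      q' = init T \<and> d' = [] \<and> letter_inv x = h"
  proof (rule ccontr)
    assume neg: "\<not> ?thesis"
    show False
    proof (cases "x \<in> set U")
      case False
      with neg d show False
        unfolding e_def by (auto dest: not_starts_with_append)
    next
      case True
      then consider "x = h" | "x = letter_inv h"
        using edge unmarked by blast
      then show False
      proof cases
        \<comment> \<open>The output begins with the marked letter itself. By \<open>neg\<close> the
          residual \<open>d\<close> is nonempty, so appending \<open>h\<close> does not make
          \<open>h\<close> its first letter, and neither does \<open>V\<close>.\<close>
        case 1
        then obtain V where V: "q = init T" "U = h # V" "h \<notin> set V"
          using edge marked by blast
        have "\<not> starts_with h (normal_form (normal_form (d @ [h]) @ V))"
          using neg 1 V d
          by (intro not_starts_with_append not_starts_with_snoc) (auto simp: reduced_normal_form)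
        then have "\<not> starts_with h e"
          unfolding e_def V(2) normal_form_append_left by simp
        with neg 1 show False by simp
      next
        \<comment> \<open>The reverse edge is the marked one, so \<open>x\<close> occurs in
          \<open>U\<close> only at the end. If everything before it cancels, \<open>d'\<close> is
          empty and the reverse edge is the marked step from \<open>(init T, [])\<close>; otherwise
          the first letter of \<open>f\<close> decides.\<close>
        case 2
        with edge' have "edge T q' h (word_inv U) q" by simp
        then obtain V where V: "q' = init T" "word_inv U = h # V" "h \<notin> set V"
          using marked by blast
        from V(2) have U: "U = word_inv V @ [x]"
          using 2 by (metis word_inv_Cons word_inv_inv)
        define f where "f = normal_form (d @ word_inv V)"
        have "\<not> starts_with x d" "x \<notin> set (word_inv V)"
          using neg V(3) 2 by (auto simp: in_set_word_inv)
        then have f: "reduced f" "\<not> starts_with x f"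
          unfolding f_def using d not_starts_with_append by (blast intro: reduced_normal_form)+
        have e: "e = normal_form (f @ [x])"
          by (simp add: e_def f_def U)
        show False
        proof (cases "f = []")
          case True
          then have "e = [x]" by (simp add: e normal_form_reduced reduced_single)
          then have "d' = []" by (simp add: d'e)
          with neg V(1) 2 show False by simp
        next
          case False
          with f have "\<not> starts_with x e"
            unfolding e by (intro not_starts_with_snoc) auto
          with neg show False by simp
        qed
      qed
    qed
  qed
  ultimately show ?thesis by blast
qed

text \<open>Each new letter at the end of \<open>w\<close> is oriented by
  \<open>step_dichotomy\<close>. A backward step lengthens \<open>l'\<close>. A forward step after a
  backward one would undo it, the graph being functional, and \<open>w\<close> would not be
  reduced.\<close>

lemma path_decomposition:
  assumes "path T (init T) w V q" "reduced w"
  shows "\<exists>l l' e. w = l @ word_inv l' \<and> run (init T, []) l e \<and>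
    run (q, normal_form (word_inv w @ V)) l' e"
  using assms
proof (induction w arbitrary: V q rule: rev_induct)
  case Nil
  then show ?case by (auto intro: exI[of _ "[]"])
next
  case (snoc x w)
  from snoc.prems(1) obtain p V1 U where
    V: "path T (init T) w V1 p" "edge T p x U q" "V = V1 @ U"
    by (auto simp: path_append path_Cons)
  define d where "d = normal_form (word_inv w @ V1)"
  define d' where "d' = normal_form (word_inv (w @ [x]) @ V)"
  have d': "d' = normal_form (letter_inv x # d @ U)"
  proof -
    have "d' = normal_form ([letter_inv x] @ (word_inv w @ V1) @ U)"
      by (simp add: d'_def V(3) word_inv_append word_inv_Cons)
    also have "\<dots> = normal_form ([letter_inv x] @ d @ U)"
      by (intro normal_form_append_cong) (simp_all add: d_def)
    finally show ?thesis by simp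
  qed
  from snoc.IH[OF V(1) reduced_appendD(1)[OF snoc.prems(2)]] obtain l l' e where
    IH: "w = l @ word_inv l'" "run (init T, []) l e" "run (p, d) l' e"
    unfolding d_def by blast
  have "reduced d" by (simp add: d_def reduced_normal_form)
  from step_dichotomy[OF V(2) this d'] show ?case
  proof
    assume fwd: "step (p, d) x (q, d')"
    have "l' = []"
    proof (cases l')
      case (Cons y k)
      with IH(3) obtain c where "step (p, d) y c" by (auto simp: run_Cons)
      with fwd have "y = x" by (auto dest: step_deterministic)
      with Cons IH(1) have "w @ [x] = (l @ word_inv k) @ [letter_inv x, letter_inv (letter_inv x)] @ []"
        by (simp add: word_inv_Cons)
      with snoc.prems(2) show ?thesis unfolding reduced_def by blast
    qed simp
    with IH fwd have "w @ [x] = (l @ [x]) @ word_inv []" "run (init T, []) (l @ [x]) (q, d')"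
      by (auto simp: run_append run_Cons)
    then show ?thesis unfolding d'_def[symmetric] by (blast intro: run.Nil)
  next
    assume "step (q, d') (letter_inv x) (p, d)"
    with IH have "w @ [x] = l @ word_inv (letter_inv x # l')" "run (q, d') (letter_inv x # l') e"
      by (auto simp: word_inv_Cons intro: run.Cons)
    with IH(2) show ?thesis unfolding d'_def[symmetric] by blast
  qed
qed

text \<open>A fixed word ends with empty residual. By \<open>proper\<close> the forward run alone
  cannot do so, hence \<open>l'\<close> is nonempty and starts at \<open>(q, [])\<close>, where a
  step exists only if \<open>q\<close> is initial. Now \<open>l\<close> and \<open>l'\<close> are
  runs from one configuration to \<open>e\<close>, distinct because \<open>w\<close> is
  nontrivial.\<close>

lemma fixed_word_run_loop:
  assumes w: "path T (init T) w V q" "reduced w" "normal_form V = w" "w \<noteq> []"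
    and proper: "\<And>l q. run (init T, []) l (q, []) \<Longrightarrow> l = []"
  shows "q = init T \<and> (\<exists>l k e. k \<noteq> [] \<and> run (init T, []) l e \<and> run e k e)"
proof -
  have "normal_form (word_inv w @ V) = []"
    using w(2,3) by (simp add: normal_form_eq_Nil_iff normal_form_reduced)
  with path_decomposition[OF w(1,2)] obtain l l' e where
    *: "w = l @ word_inv l'" "run (init T, []) l e" "run (q, []) l' e" by auto
  show ?thesis
  proof (cases l')
    case Nil
    with * proper w(4) show ?thesis by force
  next
    case (Cons x k)
    with *(3) have q: "q = init T" by (auto simp: run_Cons step_def)
    have "l \<noteq> l'"
    proof
      assume "l = l'"
      then have "normal_form w = []"
        using *(1) normal_form_word_inv_right[of "[]" l "[]"] by simp
      with w(2,4) show False by (simp add: normal_form_reduced)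
    qed
    with run_loop * q show ?thesis by metis
  qed
qed

text \<open>The invariant behind residuals: reading \<open>l\<close> with output \<open>V\<close>
  turns the residual \<open>d\<close> into \<open>l^-1 d V\<close>.\<close>

lemma run_path:
  assumes "run c l c'"
  shows "\<exists>V. path T (fst c) l V (fst c') \<and> normal_form (snd c @ V) = normal_form (l @ snd c')"
  using assms
proof induction
  case (Cons c x c' l c'')
  from Cons.hyps(1) obtain U where
    U: "edge T (fst c) x U (fst c')" "snd c' = normal_form (letter_inv x # snd c @ U)"
    by (auto simp: step_def)
  from Cons.IH obtain V where
    V: "path T (fst c') l V (fst c'')" "normal_form (snd c' @ V) = normal_form (l @ snd c'')" by blast
  have "normal_form ((x # l) @ snd c'') = normal_form ([x] @ (l @ snd c''))" by simp
  also have "\<dots> = normal_form ([x] @ (snd c' @ V))"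
    by (intro normal_form_append_cong V(2)[symmetric] refl)
  also have "\<dots> = normal_form ([x] @ (letter_inv x # snd c @ U) @ V)"
    unfolding U(2) by (intro normal_form_append_cong) auto
  also have "\<dots> = normal_form (snd c @ U @ V)"
    using normal_form_cancel_right[of "[]" x] by simp
  finally show ?case using U V by (intro exI[of _ "U @ V"]) (auto simp: path_Cons)
qed simp

text \<open>The cycle \<open>k\<close> is conjugated by the run \<open>l\<close> leading to it. With
  \<open>d\<close> the residual at \<open>e\<close>, the outputs on \<open>l\<close> and
  \<open>k\<close> equal \<open>l d\<close> and \<open>d^-1 k d\<close> in the free group, so the
  conjugate is mapped to itself.\<close>

lemma run_loop_fixed_word:
  assumes "run (init T, []) l e" "run e k e"
  shows "\<exists>V. path T (init T) (l @ k @ word_inv l) V (init T) \<and>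
    normal_form V = normal_form (l @ k @ word_inv l)"
proof -
  obtain q d where e: "e = (q, d)" by (cases e)
  from run_path[OF assms(1)] obtain V where
    V: "path T (init T) l V q" "normal_form V = normal_form (l @ d)" by (auto simp: e)
  from run_path[OF assms(2)] obtain V' where
    V': "path T q k V' q" "normal_form (d @ V') = normal_form (k @ d)" by (auto simp: e)
  have "path T (init T) (l @ k @ word_inv l) (V @ V' @ word_inv V) (init T)"
    using V(1) V'(1) path_word_inv[OF inverse V(1)] unfolding path_append by blast
  moreover have "normal_form (V @ V' @ word_inv V) = normal_form ((l @ d) @ V' @ word_inv (l @ d))"
    using V(2) by (intro normal_form_append_cong normal_form_word_inv_cong) auto
  moreover have "\<dots> = normal_form (l @ (d @ V') @ word_inv d @ word_inv l)"
    by (simp add: word_inv_append)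
  moreover have "\<dots> = normal_form (l @ (k @ d) @ word_inv d @ word_inv l)"
    by (rule normal_form_replace) (rule V'(2))
  moreover have "\<dots> = normal_form (l @ k @ word_inv l)"
    using normal_form_word_inv_right[of "l @ k" d "word_inv l"] by simp
  ultimately show ?thesis by metis
qed

end

section \<open>The transducer of a cyclic tag system\<close>

definition deterministic_edges :: "('q \<times> 'a letter \<times> 'a word \<times> 'q) set \<Rightarrow> bool" where
  "deterministic_edges E \<longleftrightarrow>
     (\<forall>q a U r U' r'. (q, a, U, r) \<in> E \<longrightarrow> (q, a, U', r') \<in> E \<longrightarrow> U = U' \<and> r = r')"

definition from_edges ::
  "'a set \<Rightarrow> 'q set \<Rightarrow> 'q \<Rightarrow> ('q \<times> 'a letter \<times> 'a word \<times> 'q) set \<Rightarrow> ('q, 'a) transducer" where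
  "from_edges A Q q\<^sub>0 E =
     \<lparr> alphabet = A, states = Q, init = q\<^sub>0,
       delta = (\<lambda>q a. if \<exists>p. (q, a, p) \<in> E then Some (snd (SOME p. (q, a, p) \<in> E)) else None),
       lam = (\<lambda>q a. if \<exists>p. (q, a, p) \<in> E then Some (fst (SOME p. (q, a, p) \<in> E)) else None) \<rparr>"

lemma from_edges_simps [simp]:
  "alphabet (from_edges A Q q\<^sub>0 E) = A" "states (from_edges A Q q\<^sub>0 E) = Q"
  "init (from_edges A Q q\<^sub>0 E) = q\<^sub>0"
  by (simp_all add: from_edges_def)

lemma edge_from_edges:
  assumes "deterministic_edges E"
  shows "edge (from_edges A Q q\<^sub>0 E) q a U r \<longleftrightarrow> (q, a, U, r) \<in> E"
proof (cases "\<exists>p. (q, a, p) \<in> E")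
  case True
  define p where "p = (SOME p. (q, a, p) \<in> E)"
  have p: "(q, a, p) \<in> E"
    unfolding p_def using True by (rule someI_ex)
  have "edge (from_edges A Q q\<^sub>0 E) q a U r \<longleftrightarrow> p = (U, r)"
    using True by (auto simp: edge_def from_edges_def p_def[symmetric])
  also have "\<dots> \<longleftrightarrow> (q, a, U, r) \<in> E"
    using p assms unfolding deterministic_edges_def by (cases p) auto
  finally show ?thesis .
qed (auto simp: edge_def from_edges_def)

fun inv_edge :: "'q \<times> 'a letter \<times> 'a word \<times> 'q \<Rightarrow> 'q \<times> 'a letter \<times> 'a word \<times> 'q" where
  "inv_edge (q, a, U, r) = (r, letter_inv a, word_inv U, q)"

definition inverse_closure ::
  "('q \<times> 'a letter \<times> 'a word \<times> 'q) set \<Rightarrow> ('q \<times> 'a letter \<times> 'a word \<times> 'q) set" where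
  "inverse_closure P = P \<union> inv_edge ` P"

lemma inv_edge_inv_edge [simp]: "inv_edge (inv_edge e) = e"
  by (cases e) simp

lemma inv_edge_image_iff: "e \<in> inv_edge ` P \<longleftrightarrow> inv_edge e \<in> P"
  by (auto intro: image_eqI[of _ _ "inv_edge e"])

text \<open>Edges in \<open>P\<close> read generators and their reversals read inverse letters, so
  the two sets never compete for an input.\<close>

lemma deterministic_inverse_closure:
  assumes "deterministic_edges P" "deterministic_edges (inv_edge ` P)"
    and "\<And>q a U r. (q, a, U, r) \<in> P \<Longrightarrow> a \<in> range Gen"
  shows "deterministic_edges (inverse_closure P)"
  unfolding deterministic_edges_def inverse_closure_def
proof (intro allI impI)
  fix q a U r U' r' assume e: "(q, a, U, r) \<in> P \<union> inv_edge ` P" "(q, a, U', r') \<in> P \<union> inv_edge ` P"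
  show "U = U' \<and> r = r'"
  proof (cases a)
    case (Gen x)
    with e assms(3) have "(q, a, U, r) \<in> P" "(q, a, U', r') \<in> P"
      by (fastforce simp: inv_edge_image_iff)+
    with assms(1) show ?thesis by (auto simp: deterministic_edges_def)
  next
    case (Inv x)
    with e assms(3) have "(q, a, U, r) \<in> inv_edge ` P" "(q, a, U', r') \<in> inv_edge ` P"
      by blast+
    with assms(2) show ?thesis unfolding deterministic_edges_def by blast
  qed
qed

lemma inverse_transducer_from_edges:
  assumes "deterministic_edges (inverse_closure P)"
  shows "inverse_transducer (from_edges A Q q\<^sub>0 (inverse_closure P))"
proof -
  have "(p, a, w, q) \<in> inverse_closure P \<longleftrightarrow> (q, letter_inv a, word_inv w, p) \<in> inverse_closure P"
    for p a w q
    by (auto simp: inverse_closure_def inv_edge_image_iff)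
  with assms show ?thesis
    unfolding inverse_transducer_def edge_from_edges[OF assms] by blast
qed

lemma finite_transducer_from_edges:
  assumes "finite A" "finite Q" "q\<^sub>0 \<in> Q"
    and P: "\<And>q a U r. (q, a, U, r) \<in> P \<Longrightarrow> q \<in> Q \<and> a \<in> letters A \<and> U \<in> words A \<and> r \<in> Q"
    and det: "deterministic_edges (inverse_closure P)"
  shows "finite_transducer (from_edges A Q q\<^sub>0 (inverse_closure P))" (is "finite_transducer ?T")
proof -
  have E: "q \<in> Q \<and> a \<in> letters A \<and> U \<in> words A \<and> r \<in> Q"
    if "(q, a, U, r) \<in> inverse_closure P" for q a U r
    using that P[of q a U r] P[of r "letter_inv a" "word_inv U" q] word_inv_in_words[of "word_inv U" A]
    by (auto simp: inverse_closure_def inv_edge_image_iff)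
  have dom: "delta ?T q a = None \<longleftrightarrow> lam ?T q a = None" for q a
    by (simp add: from_edges_def)
  have "\<exists>U. edge ?T q a U r" if "delta ?T q a = Some r" for q a r
    using that dom[of q a] by (cases "lam ?T q a") (auto simp: edge_def)
  moreover have "\<exists>r. edge ?T q a U r" if "lam ?T q a = Some U" for q a U
    using that dom[of q a] by (cases "delta ?T q a") (auto simp: edge_def)
  ultimately show ?thesis
    unfolding finite_transducer_def edge_from_edges[OF det] using assms(1-3) E dom
    by (auto 0 0) (metis in_listsD)+
qed

section \<open>Letters, outputs and edges of the tag transducer\<close>

text \<open>
  Letters \<open>x < 6\<close> have a kind \<open>x div 2\<close>, which is 0 or 1 for these bits and 2 for a blank, and a
  parity \<open>x mod 2\<close>; 6 is the marker. The output on a letter \<open>x < 6\<close> consists of letters of the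
  other parity, so it does not contain \<open>x\<close>.
\<close>

definition bit_letter :: "bool \<Rightarrow> bool \<Rightarrow> nat" where
  "bit_letter p b = (if b then 2 else 0) + (if p then 1 else 0)"

definition emit :: "bool list \<Rightarrow> nat \<Rightarrow> nat list" where
  "emit u x = map (bit_letter (even x)) (if x = 2 \<or> x = 3 then u else []) @ [if even x then 5 else 4]"

definition next_state :: "nat \<Rightarrow> nat \<Rightarrow> nat \<Rightarrow> nat" where
  "next_state m i x = (if x < 4 then Suc i mod m else i)"

text \<open>The initial state is \<open>m\<close>. The marked edge repeats its letter 6 in front of
  its output, so the residual behind it is the coded starting word; the final blank 4 keeps that
  residual nonempty even for an empty starting word.\<close>

definition forward_edges :: "cyclic_tag \<Rightarrow> (nat \<times> nat letter \<times> nat word \<times> nat) set" where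
  "forward_edges C = (let m = length (appendants C) in
     insert (m, Gen 6, map Gen (6 # map (bit_letter False) (start C) @ [4]), 0)
       {(i, Gen x, map Gen (emit (appendants C ! i) x), next_state m i x) | i x. i < m \<and> x < 6})"

definition tag_transducer :: "cyclic_tag \<Rightarrow> (nat, nat) transducer" where
  "tag_transducer C = from_edges {..6} {..length (appendants C)} (length (appendants C))
     (inverse_closure (forward_edges C))"

lemma Suc_mod_inj: "Suc i mod m = Suc j mod m \<Longrightarrow> i < m \<Longrightarrow> j < m \<Longrightarrow> i = (j::nat)"
  by (auto simp: mod_Suc split: if_splits)

text \<open>Reads the queue off a residual, forgetting the blanks and the copy from which a bit is
  taken.\<close>

definition bits :: "nat list \<Rightarrow> bool list" where
  "bits v = map (\<lambda>x. 2 \<le> x) (filter (\<lambda>x. x < 4) v)"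

lemma bits_simps [simp]:
  "bits [] = []" "bits (x # v) = (if x < 4 then [2 \<le> x] else []) @ bits v"
  "bits (v @ w) = bits v @ bits w"
  by (simp_all add: bits_def)

lemma bit_letter_less: "bit_letter p b < 4"
  by (simp add: bit_letter_def)

lemma even_bit_letter: "even (bit_letter p b) \<longleftrightarrow> \<not> p"
  by (simp add: bit_letter_def)

lemma bits_map_bit_letter: "bits (map (bit_letter p) u) = u"
  by (induction u) (simp_all add: bit_letter_def)

lemma bits_emit: "bits (emit u x) = (if x = 2 \<or> x = 3 then u else [])"
  by (simp only: emit_def bits_simps bits_map_bit_letter) simp

lemma bits_eq_Nil_iff: "bits v = [] \<longleftrightarrow> (\<forall>x\<in>set v. 4 \<le> x)"
  by (auto simp: bits_def filter_empty_conv)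

lemma in_set_emit: "y \<in> set (emit u x) \<Longrightarrow> y < 6 \<and> (even y \<longleftrightarrow> odd x)"
  unfolding emit_def set_append set_map Un_iff
  using bit_letter_less[of "even x"] even_bit_letter[of "even x"]
  by (fastforce intro: less_trans[of _ 4 6] split: if_splits)

lemma last_emit: "\<exists>ys y. emit u x = ys @ [y] \<and> 4 \<le> y"
  by (auto simp: emit_def)

locale tag_system =
  fixes C :: cyclic_tag
  assumes C: "cyclic_tag_system C"
begin

abbreviation "m \<equiv> length (appendants C)"
abbreviation "T \<equiv> tag_transducer C"
abbreviation "v\<^sub>0 \<equiv> map (bit_letter False) (start C) @ [4]"

lemma m_pos: "m > 0"
  using C unfolding cyclic_tag_system_def by linarith

lemma forward_edgesE:
  assumes "(q, a, U, r) \<in> forward_edges C"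
  obtains "q = m" "a = Gen 6" "U = map Gen (6 # v\<^sub>0)" "r = 0"
  | x where "q < m" "x < 6" "a = Gen x" "U = map Gen (emit (appendants C ! q) x)" "r = next_state m q x"
  using assms by (auto simp: forward_edges_def Let_def)

lemma deterministic: "deterministic_edges (inverse_closure (forward_edges C))"
proof (rule deterministic_inverse_closure)
  show "deterministic_edges (forward_edges C)"
    unfolding deterministic_edges_def by (auto elim!: forward_edgesE)
  \<comment> \<open>Bits shift the indices cyclically, blanks fix them, and 6 labels a single edge;
    so every letter acts injectively on the states.\<close>
  have "q = q'" if "(q, a, U, r) \<in> forward_edges C" "(q', a, U', r) \<in> forward_edges C" for q q' a U U' r
    using that by (elim forward_edgesE) (auto simp: next_state_def split: if_splits dest: Suc_mod_inj)
  then show "deterministic_edges (inv_edge ` forward_edges C)"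
    using \<open>deterministic_edges (forward_edges C)\<close>
    unfolding deterministic_edges_def inv_edge_image_iff inv_edge.simps by (metis word_inv_inv)
qed (auto elim!: forward_edgesE)

lemma inverse_T: "inverse_transducer T"
  unfolding tag_transducer_def by (intro inverse_transducer_from_edges deterministic)

lemma finite_T: "finite_transducer T"
  unfolding tag_transducer_def
proof (rule finite_transducer_from_edges)
  have Gen: "map Gen v \<in> words {..6}" if "set v \<subseteq> {..6}" for v :: "nat list"
    using that by (auto simp: letters_def image_iff subset_iff)
  show "q \<in> {..m} \<and> a \<in> letters {..6} \<and> U \<in> words {..6} \<and> r \<in> {..m}"
    if "(q, a, U, r) \<in> forward_edges C" for q a U r
    using that
  proof (cases rule: forward_edgesE)
    case 1
    have "U \<in> words {..6}"
      unfolding 1 by (intro Gen) (auto simp: bit_letter_def)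
    with 1 show ?thesis by (simp add: letters_def)
  next
    case (2 x)
    have "U \<in> words {..6}"
      unfolding 2 using in_set_emit by (intro Gen) fastforce
    with 2 m_pos show ?thesis
      by (auto simp: letters_def next_state_def less_imp_le)
  qed
qed (use deterministic in auto)

lemma edge_iff: "edge T q a U r \<longleftrightarrow> (q, a, U, r) \<in> inverse_closure (forward_edges C)"
  unfolding tag_transducer_def by (rule edge_from_edges[OF deterministic])

lemma edge_Gen: "edge T q (Gen x) U r \<longleftrightarrow> (q, Gen x, U, r) \<in> forward_edges C"
  by (auto simp: edge_iff inverse_closure_def inv_edge_image_iff elim: forward_edgesE)

lemma init_T [simp]: "init T = m"
  by (simp add: tag_transducer_def)

sublocale marked_transducer T "Gen 6"
proof
  show "inverse_transducer T" by (rule inverse_T)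
  show "p = init T \<and> (\<exists>V. U = Gen 6 # V \<and> Gen 6 \<notin> set V)" if "edge T p (Gen 6) U q" for p U q
    using that unfolding edge_Gen
    by (auto simp: bit_letter_def split: if_splits elim!: forward_edgesE)
  have *: "Gen x \<notin> set U" if "edge T p (Gen x) U q" "x \<noteq> 6" for p x U q
    using that in_set_emit unfolding edge_Gen by (fastforce elim!: forward_edgesE)
  show "x \<notin> set U" if "edge T p x U q" "x \<noteq> Gen 6" "x \<noteq> letter_inv (Gen 6)" for p x U q
  proof (cases x)
    case (Inv y)
    with that(1) inverse_T have "edge T q (Gen y) (word_inv U) p"
      unfolding inverse_transducer_def by (metis letter_inv.simps(2))
    with * that(3) Inv show ?thesis
      by (fastforce simp: in_set_word_inv)
  qed (use * that in auto)
qed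

section \<open>Simulation of the queue by configurations\<close>

lemma step_init: "step (m, []) (Gen 6) (0, map Gen v\<^sub>0)"
proof -
  have "edge T m (Gen 6) (map Gen (6 # v\<^sub>0)) 0"
    by (simp add: edge_Gen forward_edges_def Let_def)
  then show ?thesis
    using normal_form_cancel_left[of "[]" "Gen 6" "map Gen v\<^sub>0"]
    by (auto simp: step_def normal_form_reduced reduced_map_Gen simp del: map_append
        intro!: exI[of _ "map Gen (6 # v\<^sub>0)"])
qed

lemma step_queue:
  assumes "i < m" "x < 6"
  shows "step (i, map Gen (x # v)) (Gen x) (next_state m i x, map Gen (v @ emit (appendants C ! i) x))"
proof -
  have "edge T i (Gen x) (map Gen (emit (appendants C ! i) x)) (next_state m i x)"
    using assms by (auto simp: edge_Gen forward_edges_def Let_def)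
  then show ?thesis
    using normal_form_cancel_left[of "[]" "Gen x" "map Gen (v @ emit (appendants C ! i) x)"]
    by (auto simp: step_def normal_form_reduced reduced_map_Gen simp flip: map_append)
qed

text \<open>Here \<open>t\<close> counts the bits read so far. The blank that is demanded keeps the
  residual nonempty when the queue is empty.\<close>

definition simulates :: "nat \<Rightarrow> nat list \<Rightarrow> nat \<Rightarrow> bool" where
  "simulates i v t \<longleftrightarrow> i = t mod m \<and> set v \<subseteq> {..<6} \<and> (\<exists>x\<in>set v. 4 \<le> x) \<and> bits v = queue C t"

lemma simulates_init: "simulates 0 v\<^sub>0 0"
  by (auto simp: simulates_def bits_map_bit_letter bit_letter_def)

text \<open>A bit in front is the head of the queue, so reading it performs a step of the tag
  system; a blank is only rotated, leaving queue and index alone.\<close>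

lemma simulates_step:
  assumes "simulates i (x # v) t"
  shows "simulates (next_state m i x) (v @ emit (appendants C ! i) x) (if x < 4 then Suc t else t)"
proof -
  have "x = 2 \<or> x = 3 \<longleftrightarrow> 2 \<le> x" if "x < 4" using that by auto
  moreover have "\<exists>y\<in>set (emit (appendants C ! i) x). 4 \<le> y"
    using last_emit[of "appendants C ! i" x] by auto
  moreover have "set (emit (appendants C ! i) x) \<subseteq> {..<6}"
    using in_set_emit by blast
  ultimately show ?thesis
    using assms by (auto simp: simulates_def next_state_def mod_Suc_eq bits_emit
        dest!: sym[of "_ # _" "queue C t"])
qed

lemma simulates_stepD:
  assumes "simulates i v t" "step (i, map Gen v) a c"
  obtains x w where "v = x # w" "a = Gen x"
    "c = (next_state m i x, map Gen (w @ emit (appendants C ! i) x))"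
proof -
  obtain x w where v: "v = x # w" "x < 6" "i < m"
    using assms(1) m_pos by (cases v) (auto simp: simulates_def)
  from step_deterministic[OF assms(2)[unfolded v(1)] step_queue[OF v(3,2)]] v(1) that
  show ?thesis by blast
qed

lemma run_simulates:
  assumes "run c l c'" "c = (i, map Gen v)" "simulates i v t"
  shows "\<exists>i' v' t'. c' = (i', map Gen v') \<and> simulates i' v' t'"
  using assms
proof (induction arbitrary: i v t rule: run.induct)
  case (Cons c a c' l c'')
  from Cons.hyps(1) Cons.prems(1) have "step (i, map Gen v) a c'" by simp
  from simulates_stepD[OF Cons.prems(2) this] obtain x w where
    *: "v = x # w" "c' = (next_state m i x, map Gen (w @ emit (appendants C ! i) x))" by blast
  from simulates_step[OF Cons.prems(2)[unfolded *(1)]] *(2) Cons.IH show ?case by blast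
qed blast

lemma run_init:
  assumes "run (m, []) l c" "l \<noteq> []"
  shows "\<exists>i v t. c = (i, map Gen v) \<and> simulates i v t"
proof -
  obtain a k c' where l: "l = a # k" "step (m, []) a c'" "run c' k c"
    using assms by (cases l) (auto simp: run_Cons)
  have "c' = (0, map Gen v\<^sub>0)"
    using step_deterministic[OF l(2) step_init] by blast
  with run_simulates[OF l(3)] simulates_init show ?thesis by blast
qed

section \<open>Periodicity of runs and halting\<close>

text \<open>Every reading of a bit adds a blank, and the blanks in front of the first bit are used up.\<close>

definition progress :: "nat list \<Rightarrow> nat list \<Rightarrow> bool" where
  "progress v w \<longleftrightarrow>
     length (filter (\<lambda>x. 4 \<le> x) v) < length (filter (\<lambda>x. 4 \<le> x) w) \<or>
     length (filter (\<lambda>x. 4 \<le> x) v) = length (filter (\<lambda>x. 4 \<le> x) w) \<and>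
     length (takeWhile (\<lambda>x. 4 \<le> x) w) < length (takeWhile (\<lambda>x. 4 \<le> x) v)"

lemma progress_trans: "progress u v \<Longrightarrow> progress v w \<Longrightarrow> progress u w"
  by (auto simp: progress_def)

lemma progress_step:
  assumes "bits (x # v) \<noteq> []"
  shows "progress (x # v) (v @ emit u x)"
proof (cases "x < 4")
  case True
  then show ?thesis
    using last_emit[of u x] by (auto simp: progress_def)
next
  case False
  with assms obtain y where "y \<in> set v" "\<not> 4 \<le> y"
    by (auto simp: bits_eq_Nil_iff)
  \<comment> \<open>The bit \<open>y\<close> in \<open>v\<close> stops the leading blanks before the
    appended output, so the prefix has only lost \<open>x\<close>.\<close>
  then have "takeWhile (\<lambda>x. 4 \<le> x) (v @ emit u x) = takeWhile (\<lambda>x. 4 \<le> x) v"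
    by (simp add: takeWhile_append1)
  moreover have "length (filter (\<lambda>y. 4 \<le> y) (emit u x)) \<ge> 1"
    using last_emit[of u x] by auto
  ultimately show ?thesis
    using False by (auto simp: progress_def)
qed

lemma run_progress:
  assumes "run c l c'" "c = (i, map Gen v)" "simulates i v t" "\<not> halts C"
  shows "l = [] \<and> c' = c \<or> (\<exists>i' v'. c' = (i', map Gen v') \<and> progress v v')"
  using assms
proof (induction arbitrary: i v t rule: run.induct)
  case (Cons c a c' l c'')
  from Cons.hyps(1) Cons.prems(1) have "step (i, map Gen v) a c'" by simp
  from simulates_stepD[OF Cons.prems(2) this] obtain x w where
    *: "v = x # w" "c' = (next_state m i x, map Gen (w @ emit (appendants C ! i) x))" by blast
  \<comment> \<open>Without halting every simulated queue is nonempty, so a bit is always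
    left.\<close>
  have "bits v \<noteq> []"
    using Cons.prems by (auto simp: halts_def simulates_def)
  then have "progress v (w @ emit (appendants C ! i) x)"
    using * progress_step by blast
  with Cons.IH[OF *(2) simulates_step[OF Cons.prems(2)[unfolded *(1)]] Cons.prems(3)] *(2)
  show ?case by (blast intro: progress_trans)
qed blast

lemma loop_imp_halts:
  assumes "run (m, []) l e" "run e k e" "k \<noteq> []"
  shows "halts C"
proof (rule ccontr)
  assume "\<not> halts C"
  \<comment> \<open>\<open>l\<close> may be empty, but \<open>l @ k\<close> is not, so
    \<open>run_init\<close> applies to \<open>e\<close>.\<close>
  have "run (m, []) (l @ k) e"
    using assms(1,2) unfolding run_append by blast
  with assms(3) run_init obtain i v t where e: "e = (i, map Gen v)" "simulates i v t" by blast
  from run_progress[OF assms(2) e \<open>\<not> halts C\<close>] assms(3) e(1) obtain v' where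
    "map Gen v = map Gen v'" "progress v v'" by auto
  then have "progress v v" by (simp add: inj_map_eq_map inj_def)
  then show False by (simp add: progress_def)
qed

text \<open>A blank that is read moves to the end in the other copy; \<open>9 - x\<close> exchanges
  the blanks 4 and 5.\<close>

lemma run_blanks:
  assumes "i < m" "\<forall>x\<in>set d. 4 \<le> x \<and> x < 6"
  shows "run (i, map Gen (d @ w)) (map Gen d) (i, map Gen (w @ map (\<lambda>x. 9 - x) d))"
  using assms(2)
proof (induction d arbitrary: w)
  case Nil
  then show ?case by (simp add: run.Nil)
next
  case (Cons x d)
  then have x: "x = 4 \<or> x = 5" by auto
  then have "emit (appendants C ! i) x = [9 - x]" "next_state m i x = i" "x < 6"
    by (auto simp: emit_def next_state_def)
  with step_queue[OF assms(1), of x "d @ w"]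
  have "step (i, map Gen (x # d @ w)) (Gen x) (i, map Gen (d @ (w @ [9 - x])))" by simp
  from run.Cons[OF this Cons.IH] Cons.prems show ?case by simp
qed

text \<open>For each step of the tag system, the blanks in front of the first bit are rotated to the
  end and then the bit is read. Since only the queues before \<open>t\<close> are assumed nonempty,
  the time of halting is covered.\<close>

lemma run_queue:
  assumes "\<forall>s<t. queue C s \<noteq> []"
  shows "\<exists>l i v. run (m, []) l (i, map Gen v) \<and> simulates i v t"
  using assms
proof (induction t)
  case 0
  have "run (m, []) [Gen 6] (0, map Gen v\<^sub>0)"
    using step_init by (auto simp: run_Cons)
  with simulates_init show ?case by blast
next
  case (Suc t)
  then obtain l i v where IH: "run (m, []) l (i, map Gen v)" "simulates i v t" by auto
  have "bits v \<noteq> []"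
    using IH(2) Suc.prems by (simp add: simulates_def)
  then have "\<exists>x\<in>set v. \<not> 4 \<le> x" by (simp add: bits_eq_Nil_iff)
  from split_list_first_prop[OF this] obtain d x w where
    v: "v = d @ x # w" "\<not> 4 \<le> x" "\<forall>y\<in>set d. 4 \<le> y" by blast
  let ?w = "w @ map (\<lambda>y. 9 - y) d"
  have d: "\<forall>y\<in>set d. 4 \<le> y \<and> y < 6" and i: "i < m"
    using IH(2) v m_pos by (auto simp: simulates_def)
  have "run (i, map Gen v) (map Gen d) (i, map Gen (x # ?w))"
    using run_blanks[OF i d, of "x # w"] v(1) by simp
  moreover have sim: "simulates i (x # ?w) t"
  proof -
    have "bits (map (\<lambda>y. 9 - y) d) = []" "bits d = []"
      unfolding bits_eq_Nil_iff using d by auto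
    moreover have "set (map (\<lambda>y. 9 - y) d) \<subseteq> {4..<6}"
      using d by fastforce
    moreover have "(\<exists>y\<in>set d. 4 \<le> y) \<longleftrightarrow> (\<exists>y\<in>set (map (\<lambda>y. 9 - y) d). 4 \<le> y)"
      using d by force
    ultimately show ?thesis
      using IH(2) v by (auto simp: simulates_def) 
  qed
  moreover have "step (i, map Gen (x # ?w)) (Gen x)
      (next_state m i x, map Gen (?w @ emit (appendants C ! i) x))"
    using i v(2) by (intro step_queue) auto
  ultimately have "run (m, []) (l @ map Gen d @ [Gen x])
      (next_state m i x, map Gen (?w @ emit (appendants C ! i) x))"
    using IH(1) unfolding run_append run_Cons run_Nil by blast
  moreover have "simulates (next_state m i x) (?w @ emit (appendants C ! i) x) (Suc t)"
    using simulates_step[OF sim] v(2) by simp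
  ultimately show ?case by blast
qed

text \<open>When the queue first becomes empty, only blanks are left. Reading the whole residual
  flips the parity of each, so two rounds restore it.\<close>

lemma halts_imp_loop:
  assumes "halts C"
  shows "\<exists>l e k. run (m, []) l e \<and> run e (map Gen k) e \<and> k \<noteq> []"
proof -
  define t where "t = (LEAST t. queue C t = [])"
  have t: "queue C t = []" "\<forall>s<t. queue C s \<noteq> []"
    using assms unfolding halts_def t_def by (auto intro: LeastI dest: not_less_Least)
  from run_queue[OF t(2)] obtain l i v where
    *: "run (m, []) l (i, map Gen v)" "simulates i v t" by blast
  let ?w = "map (\<lambda>x. 9 - x) v"
  have v: "\<forall>x\<in>set v. 4 \<le> x \<and> x < 6" "v \<noteq> []" and i: "i < m"
    using *(2) t(1) m_pos bits_eq_Nil_iff[of v] by (auto simp: simulates_def)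
  have "map (\<lambda>x. 9 - x) ?w = v"
    using v(1) by (induction v) auto
  moreover have "\<forall>x\<in>set ?w. 4 \<le> x \<and> x < 6"
    using v(1) by auto
  ultimately have "run (i, map Gen v) (map Gen v) (i, map Gen ?w)"
    "run (i, map Gen ?w) (map Gen ?w) (i, map Gen v)"
    using run_blanks[OF i v(1), of "[]"] run_blanks[OF i, of ?w "[]"] by simp_all
  then have "run (i, map Gen v) (map Gen (v @ ?w)) (i, map Gen v)"
    unfolding map_append run_append by blast
  with * v(2) show ?thesis by blast
qed

section \<open>Fixed points and halting\<close>

lemma halts_imp_fixed_loop:
  assumes "halts C"
  shows "\<exists>g\<in>fixed_loops T. g \<noteq> \<one>\<^bsub>free_group (alphabet T)\<^esub>"
proof -
  from halts_imp_loop[OF assms] obtain l e k where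
    *: "run (m, []) l e" "run e (map Gen k) e" "k \<noteq> []" by blast
  define u where "u = l @ map Gen k @ word_inv l"
  define w where "w = normal_form u"
  from run_loop_fixed_word[of l e "map Gen k"] * obtain V where
    V: "path T (init T) u V (init T)" "normal_form V = w" by (auto simp: u_def w_def)
  from path_normal_form[OF inverse_T V(1)] V(2) obtain V' where
    V': "path T (init T) w V' (init T)" "normal_form V' = w" by (auto simp: w_def)
  have w: "reduced w" "w \<in> words (alphabet T)"
    using path_words[OF finite_T V'(1)] by (simp_all add: w_def reduced_normal_form)
  \<comment> \<open>The word is conjugate to \<open>map Gen k\<close>, which is nonempty and
    reduced, hence nontrivial.\<close>
  have "w \<noteq> []"
  proof
    assume "w = []"
    then have "normal_form (word_inv l @ u @ l) = normal_form (word_inv l @ [] @ l)"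
      by (intro normal_form_replace) (simp add: w_def)
    also have "\<dots> = []"
      using normal_form_word_inv_left[of "[]" l "[]"] by simp
    also have "normal_form (word_inv l @ u @ l) = normal_form (map Gen k)"
      using normal_form_word_inv_left[of "[]" l "map Gen k @ word_inv l @ l"]
        normal_form_word_inv_left[of "map Gen k" l "[]"] by (simp add: u_def)
    finally show False
      using *(3) by (simp add: normal_form_reduced reduced_map_Gen)
  qed
  let ?g = "represented (alphabet T) w"
  have "?g \<in> Fix T"
    using Fix_iff[OF finite_T] w(1) V' by blast
  moreover have "closed_path T (init T) (reduced_rep ?g)"
    using V'(1) w by (simp add: reduced_rep_represented normal_form_reduced closed_path_def path_def)
  moreover have "?g \<noteq> \<one>\<^bsub>free_group (alphabet T)\<^esub>"
    using w \<open>w \<noteq> []\<close> by (simp add: one_free_group represented_eq_iff normal_form_reduced)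
  ultimately show ?thesis by (auto simp: fixed_loops_def)
qed

lemma Fix_cases:
  assumes "g \<in> Fix T"
  shows "closed_path T (init T) (reduced_rep g)"
    and "g \<noteq> \<one>\<^bsub>free_group (alphabet T)\<^esub> \<Longrightarrow> halts C"
proof -
  from assms obtain w V q where
    w: "reduced w" "path T (init T) w V q" "normal_form V = w" "g = represented (alphabet T) w"
    using Fix_iff[OF finite_T] by blast
  have rep: "reduced_rep g = w"
    using w path_words[OF finite_T w(2)] by (simp add: reduced_rep_represented normal_form_reduced)
  \<comment> \<open>A simulated residual contains a blank, so it is never empty after the
    start.\<close>
  have proper: "l = []" if "run (init T, []) l (p, [])" for l p
    using run_init[of l "(p, [])"] that by (auto simp: simulates_def)
  have loop: "q = init T \<and> (\<exists>l k e. k \<noteq> [] \<and> run (init T, []) l e \<and> run e k e)" if "w \<noteq> []"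
    using fixed_word_run_loop[OF w(2,1,3) that] proper by blast
  show "closed_path T (init T) (reduced_rep g)"
    using loop w(2) by (cases "w = []") (auto simp: rep closed_path_def path_def)
  show "halts C" if "g \<noteq> \<one>\<^bsub>free_group (alphabet T)\<^esub>"
  proof -
    have "w \<noteq> []" using that w(4) by (auto simp: one_free_group)
    with loop show ?thesis unfolding init_T using loop_imp_halts by blast
  qed
qed

end

section \<open>Recursive functions on codes\<close>

text \<open>Fixing the arity allows closure properties to be proved for functions, without writing
  terms of \<open>recf\<close>.\<close>

definition computable :: "nat \<Rightarrow> (nat list \<Rightarrow> nat) \<Rightarrow> bool" where
  "computable k F \<longleftrightarrow> (\<exists>f. \<forall>xs. length xs = k \<longrightarrow> rec_eval f xs (F xs))"

lemma computable_cong: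
  "computable k F \<Longrightarrow> (\<And>xs. length xs = k \<Longrightarrow> F xs = G xs) \<Longrightarrow> computable k G"
  unfolding computable_def by metis

lemma computable_nth: "j < k \<Longrightarrow> computable k (\<lambda>xs. xs ! j)"
  unfolding computable_def by (auto intro!: exI[of _ "Proj j"] rec_eval.proj)

lemma computable_drop_nth:
  assumes "d + j < k"
  shows "computable k (\<lambda>xs. drop d xs ! j)"
  by (rule computable_cong[OF computable_nth[OF assms]]) (use assms in simp)

lemma computable_comp:
  assumes "computable (length Gs) F" "\<forall>G\<in>set Gs. computable k G"
  shows "computable k (\<lambda>xs. F (map (\<lambda>G. G xs) Gs))"
proof -
  from assms(1) obtain f where f: "\<And>xs. length xs = length Gs \<Longrightarrow> rec_eval f xs (F xs)"
    unfolding computable_def by blast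
  from assms(2) have "\<forall>G\<in>set Gs. \<exists>g. \<forall>xs. length xs = k \<longrightarrow> rec_eval g xs (G xs)"
    unfolding computable_def .
  from bchoice[OF this] obtain g where
    g: "\<And>G xs. G \<in> set Gs \<Longrightarrow> length xs = k \<Longrightarrow> rec_eval (g G) xs (G xs)" by blast
  have "rec_eval (Comp f (map g Gs)) xs (F (map (\<lambda>G. G xs) Gs))" if "length xs = k" for xs
  proof (rule rec_eval.comp)
    show "list_all2 (\<lambda>g y. rec_eval g xs y) (map g Gs) (map (\<lambda>G. G xs) Gs)"
      using g that by (simp add: list_all2_conv_all_nth)
    show "rec_eval f (map (\<lambda>G. G xs) Gs) (F (map (\<lambda>G. G xs) Gs))"
      by (intro f) simp
  qed
  then show ?thesis unfolding computable_def by blast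
qed

lemma computable_unary:
  "computable 1 (\<lambda>xs. F (xs ! 0)) \<Longrightarrow> computable k A \<Longrightarrow> computable k (\<lambda>xs. F (A xs))"
  using computable_comp[of "[A]" "\<lambda>xs. F (xs ! 0)" k] by simp

lemma computable_Suc:
  assumes "computable k A"
  shows "computable k (\<lambda>xs. Suc (A xs))"
proof (rule computable_unary[OF _ assms])
  have "rec_eval Succ xs (Suc (xs ! 0))" if "length xs = 1" for xs
    using that by (cases xs) (auto intro: rec_eval.succ)
  then show "computable 1 (\<lambda>xs. Suc (xs ! 0))"
    unfolding computable_def by blast
qed

lemma computable_const: "computable k (\<lambda>_. c)"
proof (induction c)
  case 0
  show ?case unfolding computable_def by (blast intro: rec_eval.zero)
qed (rule computable_Suc)

text \<open>\<open>PrimRec\<close> puts the counter and the previous value in front of the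
  parameters, hence the \<open>drop 2\<close>.\<close>

lemma computable_rec:
  assumes "computable k N" "computable k A"
    and "computable (Suc (Suc k)) (\<lambda>zs. G (zs ! 0) (zs ! 1) (drop 2 zs))"
  shows "computable k (\<lambda>xs. rec_nat (A xs) (\<lambda>i y. G i y xs) (N xs))"
proof -
  from assms(2) obtain f where f: "\<And>xs. length xs = k \<Longrightarrow> rec_eval f xs (A xs)"
    unfolding computable_def by blast
  from assms(3) obtain g where
    g: "\<And>zs. length zs = Suc (Suc k) \<Longrightarrow> rec_eval g zs (G (zs ! 0) (zs ! 1) (drop 2 zs))"
    unfolding computable_def by blast
  have rec: "rec_eval (PrimRec f g) (n # xs) (rec_nat (A xs) (\<lambda>i y. G i y xs) n)"
    if "length xs = k" for n xs
  proof (induction n)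
    case 0
    show ?case using f[OF that] by (auto intro: rec_eval.prim_0)
  next
    case (Suc n)
    let ?y = "rec_nat (A xs) (\<lambda>i y. G i y xs) n"
    from Suc g[of "n # ?y # xs"] that show ?case
      by (auto intro: rec_eval.prim_Suc)
  qed
  have "computable (Suc k) (\<lambda>zs. rec_nat (A (tl zs)) (\<lambda>i y. G i y (tl zs)) (hd zs))"
    unfolding computable_def
  proof (intro exI allI impI)
    fix zs :: "nat list" assume "length zs = Suc k"
    then show "rec_eval (PrimRec f g) zs (rec_nat (A (tl zs)) (\<lambda>i y. G i y (tl zs)) (hd zs))"
      using rec by (cases zs) auto
  qed
  then have "computable k (\<lambda>xs. (\<lambda>zs. rec_nat (A (tl zs)) (\<lambda>i y. G i y (tl zs)) (hd zs))
      (map (\<lambda>G. G xs) (N # map (\<lambda>j xs. xs ! j) [0..<k])))"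
    using assms(1) by (intro computable_comp) (auto intro: computable_nth)
  moreover have "map (\<lambda>j. xs ! j) [0..<k] = xs" if "length xs = k" for xs :: "nat list"
    using that map_nth by blast
  ultimately show ?thesis
    by (elim computable_cong) (simp add: comp_def)
qed

text \<open>\<open>ex\<close> makes the search terminate, and minimality supplies the nonzero
  earlier values that \<open>Mu\<close> demands.\<close>

lemma computable_Least:
  assumes "computable (Suc k) (\<lambda>zs. F (zs ! 0) (drop 1 zs))"
    and ex: "\<And>xs. length xs = k \<Longrightarrow> \<exists>n. F n xs = 0"
  shows "computable k (\<lambda>xs. LEAST n. F n xs = 0)"
proof -
  from assms(1) obtain f where
    f: "\<And>zs. length zs = Suc k \<Longrightarrow> rec_eval f zs (F (zs ! 0) (drop 1 zs))"
    unfolding computable_def by blast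
  have "rec_eval (Mu f) xs (LEAST n. F n xs = 0)" if "length xs = k" for xs
  proof (rule rec_eval.mu)
    have F: "rec_eval f (n # xs) (F n xs)" for n
      using f[of "n # xs"] that by simp
    then show "rec_eval f ((LEAST n. F n xs = 0) # xs) 0"
      using LeastI_ex[OF ex[OF that]] by metis
    show "\<forall>i<(LEAST n. F n xs = 0). \<exists>y. rec_eval f (i # xs) (Suc y)"
      using F not_less_Least by (metis not0_implies_Suc)
  qed
  then show ?thesis unfolding computable_def by blast
qed

section \<open>Arithmetic and pairing\<close>

named_theorems computable_intros

lemmas [computable_intros] = computable_const computable_nth computable_drop_nth computable_Suc computable_rec

lemma computable_add [computable_intros]:
  assumes "computable k A" "computable k B"
  shows "computable k (\<lambda>xs. A xs + B xs)"
proof -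
  have *: "a + b = rec_nat a (\<lambda>_ y. Suc y) b" for a b by (induction b) auto
  show ?thesis unfolding * by (intro computable_intros assms) simp_all
qed

lemma computable_pred:
  assumes "computable k A"
  shows "computable k (\<lambda>xs. A xs - 1)"
proof -
  have *: "a - 1 = rec_nat 0 (\<lambda>i _. i) a" for a by (cases a) auto
  show ?thesis unfolding * by (intro computable_intros assms) simp_all
qed

lemma computable_diff [computable_intros]:
  assumes "computable k A" "computable k B"
  shows "computable k (\<lambda>xs. A xs - B xs)"
proof -
  have *: "a - b = rec_nat a (\<lambda>_ y. y - 1) b" for a b by (induction b) auto
  have "computable k (\<lambda>xs. rec_nat (A xs) (\<lambda>_ y. y - 1) (B xs))"
    by (intro computable_intros computable_pred assms) simp_all
  then show ?thesis by (simp only: *[symmetric])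
qed

lemma computable_if [computable_intros]:
  assumes "computable k N" "computable k A" "computable k B"
  shows "computable k (\<lambda>xs. if N xs = 0 then A xs else B xs)"
proof -
  \<comment> \<open>Both branch values are passed as arguments, which avoids substituting into
    \<open>A\<close> and \<open>B\<close> under the recursion.\<close>
  have "computable 3 (\<lambda>xs. rec_nat (xs ! 1) (\<lambda>_ _. xs ! 2) (xs ! 0))"
    by (intro computable_intros) simp_all
  with assms have "computable k (\<lambda>xs. rec_nat (A xs) (\<lambda>_ _. B xs) (N xs))"
    using computable_comp[of "[N, A, B]" "\<lambda>xs. rec_nat (xs ! 1) (\<lambda>_ _. xs ! 2) (xs ! 0)" k]
    by (simp add: numeral_3_eq_3)
  then show ?thesis
    by (rule computable_cong) (auto simp: gr0_conv_Suc)
qed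

lemma computable_triangle [computable_intros]:
  assumes "computable k A"
  shows "computable k (\<lambda>xs. triangle (A xs))"
proof -
  have *: "triangle a = rec_nat 0 (\<lambda>i y. y + Suc i) a" for a by (induction a) auto
  show ?thesis unfolding * by (intro computable_intros assms) simp_all
qed

lemma computable_prod_encode [computable_intros]:
  "computable k A \<Longrightarrow> computable k B \<Longrightarrow> computable k (\<lambda>xs. prod_encode (A xs, B xs))"
  unfolding prod_encode_def prod.case by (intro computable_intros)

lemma triangle_mono: "a \<le> b \<Longrightarrow> triangle a \<le> triangle b"
  by (induction b) (auto simp: le_Suc_eq)

text \<open>By truncated subtraction the condition says \<open>n < triangle (Suc s)\<close>. As
  \<open>prod_encode (a, b)\<close> is \<open>triangle (a + b) + a\<close>, the search finds the
  diagonal \<open>a + b\<close>.\<close>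

definition triangle_root :: "nat \<Rightarrow> nat" where
  "triangle_root n = (LEAST s. Suc n - triangle (Suc s) = 0)"

lemma triangle_root_prod_encode: "triangle_root (prod_encode (a, b)) = a + b"
  unfolding triangle_root_def
proof (rule Least_equality)
  show "Suc (prod_encode (a, b)) - triangle (Suc (a + b)) = 0"
    by (simp add: prod_encode_def)
  fix s assume "Suc (prod_encode (a, b)) - triangle (Suc s) = 0"
  then have "triangle (a + b) < triangle (Suc s)"
    by (simp add: prod_encode_def)
  then show "a + b \<le> s"
    using triangle_mono[of "Suc s" "a + b"] by linarith
qed

lemma fst_prod_decode: "fst (prod_decode n) = n - triangle (triangle_root n)"
proof -
  obtain a b where "n = prod_encode (a, b)"
    by (metis prod_decode_inverse surj_pair)
  moreover have "prod_encode (a, b) - triangle (a + b) = a"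
    by (simp add: prod_encode_def)
  ultimately show ?thesis
    by (simp add: triangle_root_prod_encode)
qed

lemma snd_prod_decode: "snd (prod_decode n) = triangle_root n - fst (prod_decode n)"
proof -
  obtain a b where "n = prod_encode (a, b)"
    by (metis prod_decode_inverse surj_pair)
  then show ?thesis
    by (simp add: triangle_root_prod_encode)
qed

lemma computable_triangle_root [computable_intros]:
  "computable k A \<Longrightarrow> computable k (\<lambda>xs. triangle_root (A xs))"
proof (rule computable_unary[of triangle_root], unfold triangle_root_def, rule computable_Least)
  show "computable (Suc 1) (\<lambda>zs. Suc (drop 1 zs ! 0) - triangle (Suc (zs ! 0)))"
    by (intro computable_intros) simp_all
  show "\<exists>s. Suc (xs ! 0) - triangle (Suc s) = 0" for xs :: "nat list"
    by (rule exI[of _ "xs ! 0"]) simp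
qed

lemma computable_fst [computable_intros]:
  "computable k A \<Longrightarrow> computable k (\<lambda>xs. fst (prod_decode (A xs)))"
  unfolding fst_prod_decode by (intro computable_intros)

lemma computable_snd [computable_intros]:
  "computable k A \<Longrightarrow> computable k (\<lambda>xs. snd (prod_decode (A xs)))"
  unfolding snd_prod_decode by (intro computable_intros)

section \<open>Lists as numbers\<close>

definition code_cons :: "nat \<Rightarrow> nat \<Rightarrow> nat" where
  "code_cons x l = Suc (prod_encode (x, l))"

definition code_tl :: "nat \<Rightarrow> nat" where
  "code_tl l = snd (prod_decode (l - 1))"

definition code_drop :: "nat \<Rightarrow> nat \<Rightarrow> nat" where
  "code_drop n l = rec_nat l (\<lambda>_ y. code_tl y) n"

definition code_nth :: "nat \<Rightarrow> nat \<Rightarrow> nat" where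
  "code_nth l n = fst (prod_decode (code_drop n l - 1))"

definition code_length :: "nat \<Rightarrow> nat" where
  "code_length l = (LEAST n. code_drop n l = 0)"

text \<open>The recursion visits the list from its head and conses each value, which reverses the
  order; a second application restores it.\<close>

definition code_rev_map :: "(nat \<Rightarrow> nat) \<Rightarrow> nat \<Rightarrow> nat" where
  "code_rev_map h l = rec_nat 0 (\<lambda>n y. code_cons (h (code_nth l n)) y) (code_length l)"

lemma code_cons: "code_cons x (list_encode xs) = list_encode (x # xs)"
  by (simp add: code_cons_def)

lemma code_tl: "code_tl (list_encode xs) = list_encode (tl xs)"
proof -
  \<comment> \<open>The empty list has code 0, and the predecessor of 0 is 0, so this value gives
    the tail of the empty list.\<close>
  have "prod_decode 0 = (0, 0)"
    using prod_encode_inverse[of "(0, 0)"] by (simp add: prod_encode_def)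
  then show ?thesis
    by (cases xs) (simp_all add: code_tl_def)
qed

lemma code_drop: "code_drop n (list_encode xs) = list_encode (drop n xs)"
  by (induction n) (simp_all add: code_drop_def code_tl tl_drop drop_Suc)

lemma code_nth: "n < length xs \<Longrightarrow> code_nth (list_encode xs) n = xs ! n"
  using Cons_nth_drop_Suc[of n xs, symmetric] by (simp add: code_nth_def code_drop)

lemma list_encode_eq_0_iff: "list_encode xs = 0 \<longleftrightarrow> xs = []"
  by (cases xs) simp_all

lemma code_length: "code_length (list_encode xs) = length xs"
  unfolding code_length_def code_drop list_encode_eq_0_iff
  by (rule Least_equality) auto

lemma code_rev_map: "code_rev_map h (list_encode xs) = list_encode (rev (map h xs))"
proof -
  have "rec_nat 0 (\<lambda>n y. code_cons (h (code_nth (list_encode xs) n)) y) n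
      = list_encode (rev (map h (take n xs)))" if "n \<le> length xs" for n
    using that by (induction n) (simp_all add: code_nth code_cons take_Suc_conv_app_nth)
  then show ?thesis
    by (simp add: code_rev_map_def code_length)
qed

lemma computable_code_cons [computable_intros]:
  "computable k A \<Longrightarrow> computable k B \<Longrightarrow> computable k (\<lambda>xs. code_cons (A xs) (B xs))"
  unfolding code_cons_def by (intro computable_intros)

lemma computable_code_tl [computable_intros]:
  "computable k A \<Longrightarrow> computable k (\<lambda>xs. code_tl (A xs))"
  unfolding code_tl_def by (intro computable_intros)

lemma computable_code_drop [computable_intros]:
  "computable k A \<Longrightarrow> computable k B \<Longrightarrow> computable k (\<lambda>xs. code_drop (A xs) (B xs))"
  unfolding code_drop_def by (intro computable_intros) simp_all

lemma computable_code_nth [computable_intros]: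
  "computable k A \<Longrightarrow> computable k B \<Longrightarrow> computable k (\<lambda>xs. code_nth (A xs) (B xs))"
  unfolding code_nth_def by (intro computable_intros)

lemma computable_code_length [computable_intros]:
  "computable k A \<Longrightarrow> computable k (\<lambda>xs. code_length (A xs))"
proof (rule computable_unary[of code_length], unfold code_length_def, rule computable_Least)
  show "computable (Suc 1) (\<lambda>zs. code_drop (zs ! 0) (drop 1 zs ! 0))"
    by (intro computable_intros) simp_all
  \<comment> \<open>Every number codes a list, so the search succeeds on all arguments.\<close>
  show "\<exists>n. code_drop n (xs ! 0) = 0" for xs
    by (metis code_drop drop_all le_refl list_decode_inverse list_encode.simps(1))
qed

lemma computable_code_rev_map [computable_intros]:
  assumes "computable 1 (\<lambda>xs. h (xs ! 0))" "computable k A"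
  shows "computable k (\<lambda>xs. code_rev_map h (A xs))"
proof (rule computable_unary[OF _ assms(2)])
  show "computable 1 (\<lambda>xs. code_rev_map h (xs ! 0))"
    unfolding code_rev_map_def
    by (intro computable_intros computable_unary[OF assms(1)]) simp_all
qed

section \<open>Words, edges and outputs on codes\<close>

text \<open>The recursion computes the parity of \<open>c\<close>.\<close>

definition code_letter_inv :: "nat \<Rightarrow> nat" where
  "code_letter_inv c = (if rec_nat (0::nat) (\<lambda>_ y. 1 - y) c = 0 then Suc c else c - 1)"

lemma code_letter_inv: "code_letter_inv (letter_code a) = letter_code (letter_inv a)"
proof -
  have "rec_nat (0::nat) (\<lambda>_ y. 1 - y) c = c mod 2" for c
    by (induction c) (simp_all add: mod_Suc)
  then show ?thesis by (cases a) (simp_all add: code_letter_inv_def)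
qed

lemma computable_code_letter_inv [computable_intros]:
  "computable k A \<Longrightarrow> computable k (\<lambda>xs. code_letter_inv (A xs))"
  unfolding code_letter_inv_def by (intro computable_intros) simp_all

definition code_word_inv :: "nat \<Rightarrow> nat" where
  "code_word_inv = code_rev_map code_letter_inv"

lemma code_word_inv: "code_word_inv (word_code w) = word_code (word_inv w)"
  by (simp add: code_word_inv_def word_code_def code_rev_map word_inv_def rev_map comp_def code_letter_inv)

lemma computable_code_word_inv [computable_intros]:
  "computable k A \<Longrightarrow> computable k (\<lambda>xs. code_word_inv (A xs))"
  unfolding code_word_inv_def by (intro computable_intros) simp_all

definition code_add_edge :: "nat \<Rightarrow> nat \<Rightarrow> nat \<Rightarrow> nat \<Rightarrow> nat \<Rightarrow> nat" where
  "code_add_edge q c U r l =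
     code_cons (prod_encode (q, prod_encode (c, prod_encode (U, r))))
       (code_cons (prod_encode (r, prod_encode (code_letter_inv c, prod_encode (code_word_inv U, q)))) l)"

lemma code_add_edge:
  "code_add_edge q (letter_code a) (word_code U) r (list_encode (map edge_code es))
    = list_encode (map edge_code ((q, a, U, r) # inv_edge (q, a, U, r) # es))"
  by (simp only: code_add_edge_def code_letter_inv code_word_inv code_cons edge_code.simps
      inv_edge.simps list.map)

lemma computable_code_add_edge [computable_intros]:
  "computable k A \<Longrightarrow> computable k B \<Longrightarrow> computable k D \<Longrightarrow> computable k E \<Longrightarrow> computable k F \<Longrightarrow>
    computable k (\<lambda>xs. code_add_edge (A xs) (B xs) (D xs) (E xs) (F xs))"
  unfolding code_add_edge_def by (intro computable_intros)

definition code_bit_letter :: "bool \<Rightarrow> nat \<Rightarrow> nat" where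
  "code_bit_letter p b = (if b = 0 then bit_letter p False else bit_letter p True)"

text \<open>\<open>x + x\<close> is the letter code of \<open>Gen x\<close>. The inner reversal lets
  the final blank be added by one cons; the outer one restores the order.\<close>

definition code_output :: "bool \<Rightarrow> nat \<Rightarrow> nat" where
  "code_output p u =
     code_rev_map (\<lambda>x. x + x) (code_cons (if p then 5 else 4) (code_rev_map (code_bit_letter p) u))"

definition bits_code :: "bool list \<Rightarrow> nat" where
  "bits_code u = list_encode (map of_bool u)"

lemma code_bit_letter: "code_bit_letter p (of_bool b) = bit_letter p b"
  by (simp add: code_bit_letter_def)

lemma code_output:
  "code_output p (bits_code u) = word_code (map Gen (map (bit_letter p) u @ [if p then 5 else 4]))"
proof -
  have "map (\<lambda>x. x + x) v = map letter_code (map Gen v)" for v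
    by (simp add: mult_2)
  then show ?thesis
    by (simp only: code_output_def bits_code_def code_rev_map code_cons word_code_def map_map
        comp_def code_bit_letter rev.simps rev_rev_ident rev_map[symmetric] map_append list.map)
qed

lemma computable_code_output [computable_intros]:
  "computable k A \<Longrightarrow> computable k (\<lambda>xs. code_output p (A xs))"
  unfolding code_output_def code_bit_letter_def by (intro computable_intros) simp_all

section \<open>The code of the transducer\<close>

fun edges_at :: "cyclic_tag \<Rightarrow> nat \<Rightarrow> nat list \<Rightarrow> (nat \<times> nat letter \<times> nat word \<times> nat) list" where
  "edges_at C i [] = []"
| "edges_at C i (x # xs) =
    (let e = (i, Gen x, map Gen (emit (appendants C ! i) x), next_state (length (appendants C)) i x)
     in e # inv_edge e # edges_at C i xs)"

definition first_edge :: "cyclic_tag \<Rightarrow> nat \<times> nat letter \<times> nat word \<times> nat" where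
  "first_edge C =
     (length (appendants C), Gen 6, map Gen (6 # map (bit_letter False) (start C) @ [4]), 0)"

primrec edges_upto :: "cyclic_tag \<Rightarrow> nat \<Rightarrow> (nat \<times> nat letter \<times> nat word \<times> nat) list" where
  "edges_upto C 0 = [first_edge C, inv_edge (first_edge C)]"
| "edges_upto C (Suc i) = edges_at C i [0, 1, 2, 3, 4, 5] @ edges_upto C i"

lemma set_edges_at:
  "set (edges_at C i xs) = inverse_closure
    {(i, Gen x, map Gen (emit (appendants C ! i) x), next_state (length (appendants C)) i x) | x. x \<in> set xs}"
  by (induction xs) (auto simp: inverse_closure_def Let_def simp del: inv_edge.simps)

lemma inverse_closure_Un: "inverse_closure (P \<union> R) = inverse_closure P \<union> inverse_closure R"
  by (auto simp: inverse_closure_def)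

lemma set_edges_upto:
  "set (edges_upto C n) = inverse_closure (insert (first_edge C)
    {(i, Gen x, map Gen (emit (appendants C ! i) x), next_state (length (appendants C)) i x) | i x. i < n \<and> x < 6})"
proof (induction n)
  case 0
  show ?case by (simp add: inverse_closure_def insert_commute)
next
  case (Suc n)
  have six: "x \<in> set [0, 1, 2, 3, 4, 5] \<longleftrightarrow> x < 6" for x :: nat
    by auto
  show ?case
    unfolding edges_upto.simps set_append Suc.IH set_edges_at six inverse_closure_Un[symmetric]
    by (rule arg_cong[of _ _ inverse_closure]) (auto simp: less_Suc_eq)
qed

lemma set_edges: "set (edges_upto C (length (appendants C))) = inverse_closure (forward_edges C)"
  by (simp add: set_edges_upto forward_edges_def first_edge_def Let_def)

text \<open>12 is the letter code of \<open>Gen 6\<close>; the last two zeros are the target state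
  and the empty list of edges.\<close>

definition code_first_edge :: "nat \<Rightarrow> nat \<Rightarrow> nat" where
  "code_first_edge s m =
     code_add_edge m 12 (code_cons 12 (code_output False s)) 0 0"

text \<open>For \<open>i < m\<close> the value \<open>j\<close> is \<open>Suc i mod m\<close>. The
  codes 0, 2, ..., 10 stand for the generators 0 to 5, \<open>True\<close> goes with even letters,
  and the word code 0 is the empty appendant used except for letters 2 and 3.\<close>

definition code_edges_at :: "nat \<Rightarrow> nat \<Rightarrow> nat \<Rightarrow> nat \<Rightarrow> nat" where
  "code_edges_at m u i l =
     (let j = if m - Suc i = 0 then 0 else Suc i
      in code_add_edge i 0 (code_output True 0) j
        (code_add_edge i 2 (code_output False 0) j
        (code_add_edge i 4 (code_output True u) j
        (code_add_edge i 6 (code_output False u) j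
        (code_add_edge i 8 (code_output True 0) i
        (code_add_edge i 10 (code_output False 0) i l))))))"

definition code_edges :: "nat \<Rightarrow> nat \<Rightarrow> nat \<Rightarrow> nat" where
  "code_edges A s m =
     rec_nat (code_first_edge s m) (\<lambda>i l. code_edges_at m (code_nth A i) i l) m"

definition code_transducer :: "nat \<Rightarrow> nat" where
  "code_transducer c =
     (let A = fst (prod_decode c); m = code_length A
      in prod_encode (list_encode [0..<7],
           prod_encode (rec_nat (list_encode [m]) code_cons m,
             prod_encode (m, code_edges A (snd (prod_decode c)) m))))"

lemma computable_code_transducer: "computable 1 (\<lambda>xs. code_transducer (xs ! 0))"
  unfolding code_transducer_def code_edges_def code_edges_at_def code_first_edge_def Let_def
    list_encode.simps
  by (intro computable_intros) simp_all

lemma code_first_edge: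
  "code_first_edge (bits_code (start C)) (length (appendants C)) =
    list_encode (map edge_code [first_edge C, inv_edge (first_edge C)])"
proof -
  have "code_cons 12 (code_output False (bits_code (start C))) =
      word_code (map Gen (6 # map (bit_letter False) (start C) @ [4]))"
    by (simp add: code_output word_code_def code_cons del: list_encode.simps)
  then show ?thesis
    using code_add_edge[of "length (appendants C)" "Gen 6" _ 0 "[]"]
    by (simp add: code_first_edge_def first_edge_def del: list_encode.simps(2) edge_code.simps inv_edge.simps map_append)
qed

lemma code_edges_at:
  assumes "i < length (appendants C)"
  shows "code_edges_at (length (appendants C)) (bits_code (appendants C ! i)) i
      (list_encode (map edge_code es)) =
    list_encode (map edge_code (edges_at C i [0, 1, 2, 3, 4, 5] @ es))"
proof -
  let ?m = "length (appendants C)"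
  let ?u = "appendants C ! i"
  have state: "(if ?m - Suc i = 0 then 0 else Suc i) = Suc i mod ?m"
    using assms by (auto simp: mod_Suc)
  have add: "code_add_edge i (2 * x) (word_code (map Gen (emit ?u x))) (next_state ?m i x)
      (list_encode (map edge_code es)) =
    list_encode (map edge_code (edges_at C i [x] @ es))" for x es
    using code_add_edge[of i "Gen x"] by (simp add: Let_def del: edge_code.simps inv_edge.simps)
  \<comment> \<open>The output depends only on the parity and on whether the letter is a bit 1, so 0
    and 4 share it, as do 1 and 5.\<close>
  have outputs:
    "code_output True 0 = word_code (map Gen (emit ?u 0))"
    "code_output False 0 = word_code (map Gen (emit ?u 1))"
    "code_output True (bits_code ?u) = word_code (map Gen (emit ?u 2))"
    "code_output False (bits_code ?u) = word_code (map Gen (emit ?u 3))"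
    "code_output True 0 = word_code (map Gen (emit ?u 4))"
    "code_output False 0 = word_code (map Gen (emit ?u 5))"
    using code_output[of True "[]"] code_output[of False "[]"] code_output[of _ ?u]
    by (simp_all add: emit_def bits_code_def)
  have "edges_at C i [0, 1, 2, 3, 4, 5] @ es =
      edges_at C i [0] @ edges_at C i [1] @ edges_at C i [2] @ edges_at C i [3] @
      edges_at C i [4] @ edges_at C i [5] @ es"
    by (simp add: Let_def)
  then show ?thesis
    using add[of 0] add[of 1] add[of 2] add[of 3] add[of 4] add[of 5]
    unfolding code_edges_at_def Let_def state
    by (simp add: next_state_def outputs(3,4) outputs(1)[symmetric] outputs(2)[symmetric]
        outputs(5,6)[symmetric] del: edges_at.simps map_append One_nat_def)
qed

lemma code_edges:
  assumes "n \<le> length (appendants C)"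
  shows "rec_nat (code_first_edge (bits_code (start C)) (length (appendants C)))
      (\<lambda>i l. code_edges_at (length (appendants C))
        (code_nth (list_encode (map bits_code (appendants C))) i) i l) n
    = list_encode (map edge_code (edges_upto C n))"
  using assms
  by (induction n) (simp_all add: code_first_edge code_nth code_edges_at del: map_append)

lemma code_states: "rec_nat (list_encode [m]) code_cons n = list_encode (rev [0..<n] @ [m])"
  by (induction n) (simp_all add: code_cons del: list_encode.simps)

lemma transducer_code_tag_transducer:
  assumes "cyclic_tag_system C"
  shows "transducer_code (tag_transducer C) (code_transducer (cyclic_tag_code C))"
proof -
  interpret tag_system C by standard (rule assms)
  have C: "cyclic_tag_code C =
      prod_encode (list_encode (map bits_code (appendants C)), bits_code (start C))"
    unfolding cyclic_tag_code_def bits_code_def[abs_def] Let_def ..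
  have "code_transducer (cyclic_tag_code C) =
      prod_encode (list_encode [0..<7], prod_encode (list_encode (rev [0..<m] @ [m]),
        prod_encode (m, list_encode (map edge_code (edges_upto C m)))))"
    unfolding C code_transducer_def Let_def prod_encode_inverse fst_conv snd_conv code_length
      length_map code_states code_edges_def code_edges[OF le_refl] ..
  moreover have "set [0..<7] = alphabet T" "set (rev [0..<m] @ [m]) = states T"
    by (auto simp: tag_transducer_def)
  moreover have "set (edges_upto C m) = {(q, a, U, r). edge T q a U r}"
    by (auto simp: set_edges edge_iff)
  ultimately show ?thesis
    unfolding transducer_code_def init_T by blast
qed

theorem theorem3p6:
  shows "\<exists>\<T> :: cyclic_tag \<Rightarrow> (nat, nat) transducer.
    algorithmic \<T> \<and>
    (\<forall>C. cyclic_tag_system C \<longrightarrow>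
       finite_transducer (\<T> C) \<and> inverse_transducer (\<T> C) \<and>
       (halts C \<longleftrightarrow> (\<exists>w \<in> fixed_loops (\<T> C). w \<noteq> \<one>\<^bsub>free_group (alphabet (\<T> C))\<^esub>)) \<and>
       ((\<exists>w \<in> fixed_loops (\<T> C). w \<noteq> \<one>\<^bsub>free_group (alphabet (\<T> C))\<^esub>) \<longleftrightarrow>
          Fix (\<T> C) \<noteq> {\<one>\<^bsub>free_group (alphabet (\<T> C))\<^esub>}) \<and>
       (\<forall>g \<in> Fix (\<T> C). closed_path (\<T> C) (init (\<T> C)) (reduced_rep g)))"
proof (intro exI[of _ tag_transducer] conjI allI impI)
  obtain f where f: "\<And>xs. length xs = 1 \<Longrightarrow> rec_eval f xs (code_transducer (xs ! 0))"
    using computable_code_transducer unfolding computable_def by blast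
  show "algorithmic tag_transducer"
    unfolding algorithmic_def
  proof (intro exI allI impI conjI)
    fix C assume "cyclic_tag_system C"
    then show "transducer_code (tag_transducer C) (code_transducer (cyclic_tag_code C))"
      by (rule transducer_code_tag_transducer)
    show "rec_eval f [cyclic_tag_code C] (code_transducer (cyclic_tag_code C))"
      using f[of "[cyclic_tag_code C]"] by simp
  qed
next
  fix C assume "cyclic_tag_system C"
  then interpret tag_system C by unfold_locales
  let ?one = "\<one>\<^bsub>free_group (alphabet T)\<^esub>"
  show "finite_transducer T" "inverse_transducer T"
    by (rule finite_T inverse_T)+
  have sub: "fixed_loops T \<subseteq> Fix T" by (auto simp: fixed_loops_def)
  show "halts C \<longleftrightarrow> (\<exists>w\<in>fixed_loops T. w \<noteq> ?one)"
    using halts_imp_fixed_loop Fix_cases(2) sub by blast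
  \<comment> \<open>The identity is always fixed, so \<open>Fix T\<close> is nontrivial exactly if
    it has another element; such an element forces halting, which yields a fixed loop.\<close>
  show "(\<exists>w\<in>fixed_loops T. w \<noteq> ?one) \<longleftrightarrow> Fix T \<noteq> {?one}"
    using halts_imp_fixed_loop Fix_cases(2) sub one_in_Fix[OF finite_T] by blast
  show "\<forall>g\<in>Fix T. closed_path T (init T) (reduced_rep g)"
    using Fix_cases(1) by blast
qed

end
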